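(* Let $\rho : \mathbb{C}[z_1,\ldots,z_d] \to \mathcal{B}(\mathcal{H})$ be an isometric representation of the universal operator algebra for $d$ commuting contractions. If $d \ge 3$, then the tuple $(\rho(z_1),\ldots,\rho(z_d))$ is not a $d$-variable weighted shift.
   Context: $\mathbb{N} = \{0,1,2,\ldots\}$, and $\varepsilon_j \in \mathbb{N}^d$ is the multi-index whose $j$-th coordinate is $1$ and whose other coordinates are $0$. $\mathcal{B}(\mathcal{H})$ is the algebra of bounded operators on the complex Hilbert space $\mathcal{H}$. Universal operator algebra for $d$ commuting contractions: the algebra $\mathbb{C}[z_1,\ldots,z_d]$ equipped with the norm $\|p\|_u = \sup \|p(T_1,\ldots,T_d)\|$, the supremum being taken over all $d$-tuples $(T_1,\ldots,T_d)$ of commuting contractions on Hilbert spaces (and the analogous norms on matrices of polynomials). There is a $d$-tuple $(S_1,\ldots,S_d)$ of commuting contractions on a Hilbert space attaining this supremum for all (matrices of) polynomials $p$. An isometric representation is a unital algebra homomorphism $\rho$ with $\|\rho(p)\| = \|p\|_u$ for all $p \in \mathbb{C}[z_1,\ldots,z_d]$. $d$-variable weighted shift: a $d$-tuple $(T_1,\ldots,T_d)$ of bounded operators on a Hilbert space $\mathcal{H}$ is a $d$-variable weighted shift if $\mathcal{H}$ has an orthonormal basis $\{e_I : I \in \mathbb{N}^d\}$ and there is a bounded collection $(w_{I,j})_{(I,j)\in \mathbb{N}^d \times \{1,\ldots,d\}}$ of strictly positive real numbers satisfying $w_{I,j}\, w_{I+\varepsilon_j,k} = w_{I,k}\, w_{I+\varepsilon_k,j}$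 for all $I \in \mathbb{N}^d$ and $j,k \in \{1,\ldots,d\}$ such that $T_j e_I = w_{I,j} e_{I+\varepsilon_j}$ for all $I$ and $j$. *)

theory Defs
  imports
    "HOL-Analysis.Analysis"
    "HOL-Library.Poly_Mapping"
    "HOL-Algebra.Algebraic_Closure_Type"
begin

section \<open>Complex Hilbert spaces\<close>

text \<open>
  A supremum over all Hilbert spaces has to range over different Hilbert spaces inside one HOL
  type, so Hilbert spaces are explicit structures with a carrier set, built on the modules of
  HOL-Algebra over the field of complex numbers. The record fields for a multiplication and a unit
  that \<open>module\<close> inherits from \<open>ring\<close> play no role.
\<close>

record 'a inner_product_structure = "(complex, 'a) module" +
  cinner :: "'a \<Rightarrow> 'a \<Rightarrow> complex"

definition hnorm :: "'a inner_product_structure \<Rightarrow> 'a \<Rightarrow> real" where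
  "hnorm H x = sqrt (Re (cinner H x x))"

locale complex_hilbert_space =
  Module.module "ring_of_type_algebra :: complex ring" H
  for H :: "'a inner_product_structure" (structure) +
  assumes cinner_add_left:
      "\<lbrakk>x \<in> carrier H; y \<in> carrier H; z \<in> carrier H\<rbrakk>
        \<Longrightarrow> cinner H (x \<oplus>\<^bsub>H\<^esub> y) z = cinner H x z + cinner H y z"
    and cinner_smult_left:
      "\<lbrakk>x \<in> carrier H; y \<in> carrier H\<rbrakk> \<Longrightarrow> cinner H (c \<odot>\<^bsub>H\<^esub> x) y = c * cinner H x y"
    and cinner_commute:
      "\<lbrakk>x \<in> carrier H; y \<in> carrier H\<rbrakk> \<Longrightarrow> cinner H x y = cnj (cinner H y x)"
    and cinner_pos:
      "\<lbrakk>x \<in> carrier H; x \<noteq> \<zero>\<^bsub>H\<^esub>\<rbrakk> \<Longrightarrow> Re (cinner H x x) > 0"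
    and complete:
      "\<lbrakk>\<And>n. s n \<in> carrier H;
        \<And>e. e > 0 \<Longrightarrow> \<exists>N. \<forall>m\<ge>N. \<forall>n\<ge>N. hnorm H (s m \<ominus>\<^bsub>H\<^esub> s n) < e\<rbrakk>
        \<Longrightarrow> \<exists>x\<in>carrier H. (\<lambda>n. hnorm H (s n \<ominus>\<^bsub>H\<^esub> x)) \<longlonglongrightarrow> 0"


section \<open>Bounded operators\<close>

text \<open>
  Operators are functions on the underlying type whose values outside the carrier are irrelevant;
  equality of operators is therefore always stated pointwise on the carrier.
\<close>

definition bounded_operators :: "'a inner_product_structure \<Rightarrow> ('a \<Rightarrow> 'a) set" where
  "bounded_operators H = {A.
     (\<forall>x\<in>carrier H. A x \<in> carrier H) \<and>
     (\<forall>x\<in>carrier H. \<forall>y\<in>carrier H. A (x \<oplus>\<^bsub>H\<^esub> y) = A x \<oplus>\<^bsub>H\<^esub> A y) \<and>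
     (\<forall>c. \<forall>x\<in>carrier H. A (c \<odot>\<^bsub>H\<^esub> x) = c \<odot>\<^bsub>H\<^esub> A x) \<and>
     (\<exists>C. \<forall>x\<in>carrier H. hnorm H (A x) \<le> C * hnorm H x)}"

definition op_norm :: "'a inner_product_structure \<Rightarrow> ('a \<Rightarrow> 'a) \<Rightarrow> real" where
  "op_norm H A = (SUP x\<in>{x \<in> carrier H. hnorm H x \<le> 1}. hnorm H (A x))"

definition commuting_contractions ::
    "'a inner_product_structure \<Rightarrow> nat \<Rightarrow> (nat \<Rightarrow> 'a \<Rightarrow> 'a) \<Rightarrow> bool" where
  "commuting_contractions H d T \<longleftrightarrow>
     (\<forall>j\<in>{1..d}. T j \<in> bounded_operators H \<and> op_norm H (T j) \<le> 1) \<and>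
     (\<forall>j\<in>{1..d}. \<forall>k\<in>{1..d}. \<forall>x\<in>carrier H. T j (T k x) = T k (T j x))"


section \<open>Polynomials in d variables\<close>

type_synonym multi_index = "nat \<Rightarrow>\<^sub>0 nat"

text \<open>The product on \<open>\<Rightarrow>\<^sub>0\<close> is convolution, so this is the usual ring of polynomials.\<close>

type_synonym cpoly = "multi_index \<Rightarrow>\<^sub>0 complex"

definition multi_indices :: "nat \<Rightarrow> multi_index set" where
  "multi_indices d = {I. Poly_Mapping.keys I \<subseteq> {1..d}}"

definition unit_index :: "nat \<Rightarrow> multi_index" where
  "unit_index j = Poly_Mapping.single j 1"

definition polys :: "nat \<Rightarrow> cpoly set" where
  "polys d = {p. Poly_Mapping.keys p \<subseteq> multi_indices d}"

definition const_poly :: "complex \<Rightarrow> cpoly" where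
  "const_poly c = Poly_Mapping.single 0 c"

definition var_poly :: "nat \<Rightarrow> cpoly" where
  "var_poly j = Poly_Mapping.single (unit_index j) 1"

text \<open>
  \<open>T\<^sub>1 ^ I\<^sub>1 \<circ> \<dots> \<circ> T\<^sub>d ^ I\<^sub>d\<close>; it is only used for commuting tuples, where the
  order of the factors is immaterial.
\<close>

definition monomial_op :: "nat \<Rightarrow> (nat \<Rightarrow> 'a \<Rightarrow> 'a) \<Rightarrow> multi_index \<Rightarrow> 'a \<Rightarrow> 'a" where
  "monomial_op d T I = foldr (\<lambda>j A. (T j ^^ Poly_Mapping.lookup I j) \<circ> A) [1..<Suc d] id"

definition poly_op ::
    "'a inner_product_structure \<Rightarrow> nat \<Rightarrow> (nat \<Rightarrow> 'a \<Rightarrow> 'a) \<Rightarrow> cpoly \<Rightarrow> 'a \<Rightarrow> 'a" where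
  "poly_op H d T p x = (\<Oplus>\<^bsub>H\<^esub>I\<in>Poly_Mapping.keys p. Poly_Mapping.lookup p I \<odot>\<^bsub>H\<^esub> monomial_op d T I x)"


section \<open>The universal operator algebra for d commuting contractions\<close>

text \<open>
  HOL cannot quantify over types inside a term, so the universal norm is relative to a universe type
  \<open>'u\<close>: the supremum ranges over all Hilbert spaces whose carrier is a subset of \<open>'u\<close>. As soon as
  \<open>'u\<close> has at least continuum many elements, its value is the supremum over all Hilbert spaces
  whatsoever, because the norm of \<open>p(T)\<close> is the supremum of its norms on the closed invariant
  subspaces generated by single vectors, and these are separable. (A smaller \<open>'u\<close> contains
  only zero spaces, and then the norm is 0.) The set is nonempty, since the zero space is admitted,
  and bounded by the sum of the absolute values of the coefficients of \<open>p\<close>.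
\<close>

definition universal_norm :: "'u itself \<Rightarrow> nat \<Rightarrow> cpoly \<Rightarrow> real" where
  "universal_norm U d p =
     Sup {op_norm K (poly_op K d T p) | (K :: 'u inner_product_structure) T.
            complex_hilbert_space K \<and> commuting_contractions K d T}"

definition isometric_representation ::
    "'u itself \<Rightarrow> nat \<Rightarrow> 'a inner_product_structure \<Rightarrow> (cpoly \<Rightarrow> 'a \<Rightarrow> 'a) \<Rightarrow> bool" where
  "isometric_representation U d H \<rho> \<longleftrightarrow>
     (\<forall>p\<in>polys d. \<rho> p \<in> bounded_operators H) \<and>
     (\<forall>p\<in>polys d. \<forall>q\<in>polys d. \<forall>x\<in>carrier H. \<rho> (p + q) x = \<rho> p x \<oplus>\<^bsub>H\<^esub> \<rho> q x) \<and>
     (\<forall>c. \<forall>p\<in>polys d. \<forall>x\<in>carrier H. \<rho> (const_poly c * p) x = c \<odot>\<^bsub>H\<^esub> \<rho> p x) \<and>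
     (\<forall>p\<in>polys d. \<forall>q\<in>polys d. \<forall>x\<in>carrier H. \<rho> (p * q) x = \<rho> p (\<rho> q x)) \<and>
     (\<forall>x\<in>carrier H. \<rho> 1 x = x) \<and>
     (\<forall>p\<in>polys d. op_norm H (\<rho> p) = universal_norm U d p)"


section \<open>Weighted shifts in d variables\<close>

text \<open>The second condition says that the linear span of the family is dense.\<close>

definition orthonormal_basis ::
    "'a inner_product_structure \<Rightarrow> 'i set \<Rightarrow> ('i \<Rightarrow> 'a) \<Rightarrow> bool" where
  "orthonormal_basis H \<I> e \<longleftrightarrow>
     (\<forall>i\<in>\<I>. e i \<in> carrier H) \<and>
     (\<forall>i\<in>\<I>. \<forall>j\<in>\<I>. cinner H (e i) (e j) = (if i = j then 1 else 0)) \<and>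
     (\<forall>x\<in>carrier H. \<forall>\<epsilon>>0. \<exists>F c. finite F \<and> F \<subseteq> \<I> \<and>
        hnorm H (x \<ominus>\<^bsub>H\<^esub> (\<Oplus>\<^bsub>H\<^esub>i\<in>F. c i \<odot>\<^bsub>H\<^esub> e i)) < \<epsilon>)"

definition weighted_shift ::
    "'a inner_product_structure \<Rightarrow> nat \<Rightarrow> (nat \<Rightarrow> 'a \<Rightarrow> 'a) \<Rightarrow> bool" where
  "weighted_shift H d T \<longleftrightarrow>
     (\<forall>j\<in>{1..d}. T j \<in> bounded_operators H) \<and>
     (\<exists>(e :: multi_index \<Rightarrow> 'a) (w :: multi_index \<Rightarrow> nat \<Rightarrow> real).
        orthonormal_basis H (multi_indices d) e \<and>
        (\<exists>C. \<forall>I\<in>multi_indices d. \<forall>j\<in>{1..d}. 0 < w I j \<and> w I j \<le> C) \<and>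
        (\<forall>I\<in>multi_indices d. \<forall>j\<in>{1..d}. \<forall>k\<in>{1..d}.
           w I j * w (I + unit_index j) k = w I k * w (I + unit_index k) j) \<and>
        (\<forall>I\<in>multi_indices d. \<forall>j\<in>{1..d}.
           T j (e I) = complex_of_real (w I j) \<odot>\<^bsub>H\<^esub> e (I + unit_index j)))"

end

theory Submission
  imports Defs
begin

text \<open>
  A weighted shift whose operators are contractions satisfies von Neumann's inequality
  \<open>\<parallel>p(T)\<parallel> \<le> sup |p|\<close> over the torus, whereas in at least three variables there are commuting
  contractions that do not. So the norms of a weighted shift cannot all be the universal ones.

  The first half is \<open>von_neumann_inequality\<close>. Let \<open>\<beta> I\<close> be the norm of \<open>T\<^sup>I e\<^sub>0\<close>, so that
  \<open>T\<^sup>I e\<^sub>0 = \<beta> I \<cdot> e\<^sub>I\<close>. The vectors \<open>q(T) e\<^sub>0\<close> are dense and their squared norms are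
  \<open>\<Sum>\<^sub>I |q\<^sub>I|\<^sup>2 \<beta>(I)\<^sup>2\<close>: the weighted shift is multiplication by the variables on a weighted
  sequence space. Contractivity makes \<open>\<beta>\<close> decreasing, so each superlevel set
  \<open>D = {I. \<beta>(I)\<^sup>2 > t}\<close> is closed downwards. The coefficients of \<open>p q\<close> on such a set depend only
  on the coefficients of \<open>q\<close> on it, so the unweighted estimate
  \<open>\<Sum>\<^sub>I |(p q)\<^sub>I|\<^sup>2 \<le> sup |p|\<^sup>2 \<cdot> \<Sum>\<^sub>I |q\<^sub>I|\<^sup>2\<close>, a consequence of Parseval's identity, also holds with
  both sums restricted to \<open>D\<close>. Integrating over \<open>t\<close> (the layer-cake principle) gives the estimate
  with the weights \<open>\<beta>(I)\<^sup>2\<close>, which is \<open>mult_weighted_l2_bound\<close>.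

  For the second half, let \<open>p = z\<^sub>1\<^sup>2 + z\<^sub>2\<^sup>2 + z\<^sub>3\<^sup>2 - 2 z\<^sub>1 z\<^sub>2 - 2 z\<^sub>1 z\<^sub>3 - 2 z\<^sub>2 z\<^sub>3\<close> be the polynomial of
  Kaijser and Varopoulos. It is bounded by 5 on the torus, but \<open>op_norm_transported_kv\<close> exhibits
  commuting contractions on a space of dimension five for which \<open>p(T)\<close> has norm at least
  \<open>9 / sqrt 3 > 5\<close>.

  The universal norm only sees Hilbert spaces inside the type \<open>'u\<close>. If \<open>'u\<close> carried nothing but
  zero spaces, 1 and 0 would have the same universal norm (\<open>universal_norm_trivial\<close>), which an
  isometric representation on a space with a unit vector rules out. Otherwise \<open>'u\<close> contains a
  complex line, hence as many points as \<open>\<complex>\<^sup>5\<close>, and the five-dimensional example can be transported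
  into it (\<open>ex_inj_complex5\<close>).
\<close>

section \<open>Evaluation of polynomials\<close>

definition eval_poly :: "nat \<Rightarrow> (nat \<Rightarrow> complex) \<Rightarrow> cpoly \<Rightarrow> complex" where
  "eval_poly d z p =
     (\<Sum>I\<in>Poly_Mapping.keys p. Poly_Mapping.lookup p I * (\<Prod>j\<in>{1..d}. z j ^ Poly_Mapping.lookup I j))"

lemma eval_poly_superset:
  assumes "finite A" "Poly_Mapping.keys p \<subseteq> A"
  shows "eval_poly d z p = (\<Sum>I\<in>A. Poly_Mapping.lookup p I * (\<Prod>j\<in>{1..d}. z j ^ Poly_Mapping.lookup I j))"
  unfolding eval_poly_def
  by (rule sum.mono_neutral_left) (use assms in \<open>auto simp: in_keys_iff\<close>)

lemma eval_poly_add: "eval_poly d z (p + q) = eval_poly d z p + eval_poly d z q"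
proof -
  let ?A = "Poly_Mapping.keys p \<union> Poly_Mapping.keys q"
  have "Poly_Mapping.keys (p + q) \<subseteq> ?A" by (rule keys_add)
  then show ?thesis
    by (simp add: eval_poly_superset[of ?A] lookup_add sum.distrib algebra_simps)
qed

lemma eval_poly_single:
  "eval_poly d z (Poly_Mapping.single I c) = c * (\<Prod>j\<in>{1..d}. z j ^ Poly_Mapping.lookup I j)"
  by (simp add: eval_poly_superset[of "{I}"])

lemma eval_poly_zero: "eval_poly d z 0 = 0"
  by (simp add: eval_poly_def)

lemma eval_poly_sum: "eval_poly d z (\<Sum>i\<in>A. f i) = (\<Sum>i\<in>A. eval_poly d z (f i))"
  by (induction A rule: infinite_finite_induct) (simp_all add: eval_poly_zero eval_poly_add)

lemma poly_mapping_sum_singles: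
  fixes p :: "'i \<Rightarrow>\<^sub>0 'c::comm_monoid_add"
  shows "p = (\<Sum>I\<in>Poly_Mapping.keys p. Poly_Mapping.single I (Poly_Mapping.lookup p I))"
proof (rule poly_mapping_eqI)
  fix k
  have "(\<Sum>I\<in>Poly_Mapping.keys p. Poly_Mapping.lookup (Poly_Mapping.single I (Poly_Mapping.lookup p I)) k)
      = (\<Sum>I\<in>Poly_Mapping.keys p. if I = k then Poly_Mapping.lookup p I else 0)"
    by (rule sum.cong) (auto simp: lookup_single when_def)
  then show "Poly_Mapping.lookup p k =
      Poly_Mapping.lookup (\<Sum>I\<in>Poly_Mapping.keys p. Poly_Mapping.single I (Poly_Mapping.lookup p I)) k"
    by (simp add: lookup_sum in_keys_iff)
qed

lemma eval_poly_mult: "eval_poly d z (p * q) = eval_poly d z p * eval_poly d z q"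
proof -
  let ?s = "\<lambda>p I. Poly_Mapping.single I (Poly_Mapping.lookup p I)"
  have "p * q = (\<Sum>I\<in>Poly_Mapping.keys p. \<Sum>J\<in>Poly_Mapping.keys q. ?s p I * ?s q J)"
    unfolding sum_product[symmetric] by (simp only: poly_mapping_sum_singles[symmetric])
  then have "eval_poly d z (p * q) =
      (\<Sum>I\<in>Poly_Mapping.keys p. \<Sum>J\<in>Poly_Mapping.keys q. eval_poly d z (?s p I) * eval_poly d z (?s q J))"
    by (simp add: eval_poly_sum mult_single eval_poly_single lookup_add power_add prod.distrib
        mult_ac)
  also have "\<dots> = eval_poly d z p * eval_poly d z q"
    by (simp add: sum_product eval_poly_single) (simp add: eval_poly_def sum_product)
  finally show ?thesis .
qed

lemma multi_indices_add:
  "I \<in> multi_indices d \<Longrightarrow> J \<in> multi_indices d \<Longrightarrow> I + J \<in> multi_indices d"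
  unfolding multi_indices_def using keys_add[of I J] by auto

lemma polys_mult: "p \<in> polys d \<Longrightarrow> q \<in> polys d \<Longrightarrow> p * q \<in> polys d"
  unfolding polys_def using keys_mult[of p q] by (blast dest: multi_indices_add)

lemma polys_add: "p \<in> polys d \<Longrightarrow> q \<in> polys d \<Longrightarrow> p + q \<in> polys d"
  unfolding polys_def using keys_add[of p q] by auto

lemma polys_zero: "0 \<in> polys d"
  by (simp add: polys_def)

lemma polys_sum: "(\<And>i. i \<in> A \<Longrightarrow> f i \<in> polys d) \<Longrightarrow> (\<Sum>i\<in>A. f i) \<in> polys d"
  by (induction A rule: infinite_finite_induct) (auto simp: polys_zero intro: polys_add)

lemma polys_single: "I \<in> multi_indices d \<Longrightarrow> Poly_Mapping.single I c \<in> polys d"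
  by (simp add: polys_def)

lemma unit_index_in: "j \<in> {1..d} \<Longrightarrow> unit_index j \<in> multi_indices d"
  by (simp add: unit_index_def multi_indices_def)


section \<open>Multiplication by a polynomial on weighted sequence spaces\<close>

lemma roots_of_unity_orthogonal:
  assumes "a < N" "b < N"
  shows "(\<Sum>m<N. cis (2 * pi * real m / real N) ^ a * cnj (cis (2 * pi * real m / real N) ^ b)) =
    (if a = b then of_nat N else 0)"
proof -
  define \<zeta> where "\<zeta> = cis (2 * pi * (real a - real b) / real N)"
  have N: "real N > 0" using assms by simp
  have eq: "cis (2 * pi * real m / real N) ^ a * cnj (cis (2 * pi * real m / real N) ^ b) = \<zeta> ^ m" for m
    unfolding \<zeta>_def Complex.DeMoivre cis_cnj cis_mult
    by (rule arg_cong[where f = cis]) (use N in \<open>simp add: field_simps\<close>)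
  show ?thesis
  proof (cases "a = b")
    case True
    then show ?thesis unfolding eq by (simp add: \<zeta>_def)
  next
    case False
    have "\<zeta> ^ N = cis (2 * pi * (real a - real b))"
      unfolding \<zeta>_def Complex.DeMoivre using N by (simp add: field_simps)
    also have "\<dots> = cis (2 * pi * of_int (int a - int b))" by simp
    also have "\<dots> = 1" by (rule cis_multiple_2pi) simp
    finally have 1: "\<zeta> ^ N = 1" .
    have "\<zeta> \<noteq> 1"
    proof
      assume "\<zeta> = 1"
      then have "exp (\<i> * complex_of_real (2 * pi * (real a - real b) / real N)) = 1"
        by (simp add: \<zeta>_def cis_conv_exp)
      then obtain n :: int where "2 * pi * (real a - real b) / real N = of_int (2 * n) * pi"
        by (auto simp: exp_eq_1)
      then have "2 * pi * (real a - real b) = 2 * pi * (of_int n * real N)"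
        using N by (simp add: field_simps)
      then have "real a - real b = of_int n * real N" by simp
      then have "real_of_int (int a - int b) = real_of_int (n * int N)" by simp
      then have "int a - int b = n * int N" by (simp only: of_int_eq_iff)
      moreover have "\<bar>int a - int b\<bar> < int N" using assms by auto
      ultimately have "\<bar>n\<bar> * int N < 1 * int N" by (simp add: abs_mult)
      then have "\<bar>n\<bar> < 1" by (rule mult_right_less_imp_less) simp
      then show False using \<open>int a - int b = n * int N\<close> False by simp
    qed
    then show ?thesis unfolding eq using False 1 by (simp add: geometric_sum)
  qed
qed

lemma multi_index_eqI:
  assumes "I \<in> multi_indices d" "J \<in> multi_indices d"
    "\<And>j. j \<in> {1..d} \<Longrightarrow> Poly_Mapping.lookup I j = Poly_Mapping.lookup J j"
  shows "I = J"
proof (rule poly_mapping_eqI)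
  fix j
  show "Poly_Mapping.lookup I j = Poly_Mapping.lookup J j"
  proof (cases "j \<in> {1..d}")
    case False
    then have "j \<notin> Poly_Mapping.keys I" "j \<notin> Poly_Mapping.keys J"
      using assms(1,2) by (auto simp: multi_indices_def)
    then show ?thesis by (simp add: in_keys_iff)
  qed (rule assms(3))
qed

definition grid :: "nat \<Rightarrow> nat \<Rightarrow> (nat \<Rightarrow> nat) set" where
  "grid d N = PiE {1..d} (\<lambda>_. {..<N})"

definition grid_point :: "nat \<Rightarrow> (nat \<Rightarrow> nat) \<Rightarrow> nat \<Rightarrow> complex" where
  "grid_point N n j = cis (2 * pi * real (n j) / real N)"

text \<open>
  Parseval's identity on the finite group \<open>(\<int> / N)\<^sup>d\<close>: once \<open>N\<close> exceeds all exponents, distinct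
  monomials restrict to distinct characters, so a finite average replaces the integral over the
  torus.
\<close>
lemma parseval:
  assumes q: "q \<in> polys d" and N: "\<And>I j. I \<in> Poly_Mapping.keys q \<Longrightarrow> j \<in> {1..d} \<Longrightarrow> Poly_Mapping.lookup I j < N"
  shows "(\<Sum>n\<in>grid d N. (cmod (eval_poly d (grid_point N n) q))\<^sup>2) =
    real N ^ d * (\<Sum>I\<in>Poly_Mapping.keys q. (cmod (Poly_Mapping.lookup q I))\<^sup>2)"
proof -
  let ?K = "Poly_Mapping.keys q" and ?q = "Poly_Mapping.lookup q"
  let ?\<chi> = "\<lambda>n I. \<Prod>j\<in>{1..d}. grid_point N n j ^ Poly_Mapping.lookup I j"
  have orth: "(\<Sum>n\<in>grid d N. ?\<chi> n I * cnj (?\<chi> n J)) = (if I = J then of_nat N ^ d else 0)"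
    if I: "I \<in> ?K" and J: "J \<in> ?K" for I J
  proof -
    have "(\<Sum>n\<in>grid d N. ?\<chi> n I * cnj (?\<chi> n J)) = (\<Sum>n\<in>PiE {1..d} (\<lambda>_. {..<N}). \<Prod>j\<in>{1..d}.
        cis (2 * pi * real (n j) / real N) ^ Poly_Mapping.lookup I j *
        cnj (cis (2 * pi * real (n j) / real N) ^ Poly_Mapping.lookup J j))"
      by (simp only: grid_def grid_point_def prod.distrib cnj_prod)
    also have "\<dots> = (\<Prod>j\<in>{1..d}. \<Sum>m<N. cis (2 * pi * real m / real N) ^ Poly_Mapping.lookup I j *
        cnj (cis (2 * pi * real m / real N) ^ Poly_Mapping.lookup J j))"
      by (rule prod_sum_PiE[symmetric]) auto
    also have "\<dots> = (\<Prod>j\<in>{1..d}. if Poly_Mapping.lookup I j = Poly_Mapping.lookup J j then of_nat N else 0)"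
      by (rule prod.cong[OF refl], rule roots_of_unity_orthogonal) (use I J N in auto)
    also have "\<dots> = (if I = J then of_nat N ^ d else 0)"
    proof (cases "I = J")
      case False
      then obtain j where "j \<in> {1..d}" "Poly_Mapping.lookup I j \<noteq> Poly_Mapping.lookup J j"
        using multi_index_eqI[of I d J] I J q by (auto simp: polys_def)
      then show ?thesis using False by (auto intro!: prod_zero)
    qed simp
    finally show ?thesis .
  qed
  have "complex_of_real (\<Sum>n\<in>grid d N. (cmod (eval_poly d (grid_point N n) q))\<^sup>2) =
      (\<Sum>n\<in>grid d N. \<Sum>I\<in>?K. \<Sum>J\<in>?K. ?q I * cnj (?q J) * (?\<chi> n I * cnj (?\<chi> n J)))"
    unfolding of_real_sum complex_norm_square eval_poly_def cnj_sum sum_product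
    by (intro sum.cong refl) simp
  also have "\<dots> = (\<Sum>I\<in>?K. \<Sum>J\<in>?K. ?q I * cnj (?q J) * (\<Sum>n\<in>grid d N. ?\<chi> n I * cnj (?\<chi> n J)))"
    unfolding sum_distrib_left
    by (subst sum.swap, rule sum.cong[OF refl], subst sum.swap, rule refl)
  also have "\<dots> = (\<Sum>I\<in>?K. \<Sum>J\<in>?K. if I = J then ?q I * cnj (?q J) * of_nat N ^ d else 0)"
    by (intro sum.cong refl, subst orth) auto
  also have "\<dots> = complex_of_real (real N ^ d * (\<Sum>I\<in>?K. (cmod (?q I))\<^sup>2))"
    unfolding of_real_mult of_real_sum complex_norm_square
    by (simp add: sum_distrib_left mult_ac)
  finally show ?thesis by (simp only: of_real_eq_iff)
qed

text \<open>
  Evaluation turns the product of polynomials into a pointwise product of functions on the torus,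
  where multiplying by \<open>p\<close> costs at most the supremum of \<open>|p|\<close>; Parseval's identity translates this
  back to coefficients.
\<close>
lemma mult_l2_bound:
  assumes p: "p \<in> polys d" and q: "q \<in> polys d" and c: "c \<ge> 0"
    and bound: "\<And>z. (\<And>j. j \<in> {1..d} \<Longrightarrow> cmod (z j) = 1) \<Longrightarrow> cmod (eval_poly d z p) \<le> c"
  shows "(\<Sum>I\<in>Poly_Mapping.keys (p * q). (cmod (Poly_Mapping.lookup (p * q) I))\<^sup>2) \<le>
    c\<^sup>2 * (\<Sum>I\<in>Poly_Mapping.keys q. (cmod (Poly_Mapping.lookup q I))\<^sup>2)"
proof -
  define N where "N = Suc (\<Sum>I\<in>Poly_Mapping.keys q \<union> Poly_Mapping.keys (p * q). \<Sum>j\<in>{1..d}. Poly_Mapping.lookup I j)"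
  have N: "Poly_Mapping.lookup I j < N"
    if "I \<in> Poly_Mapping.keys q \<union> Poly_Mapping.keys (p * q)" "j \<in> {1..d}" for I j
  proof -
    have "Poly_Mapping.lookup I j \<le> (\<Sum>j\<in>{1..d}. Poly_Mapping.lookup I j)"
      by (rule member_le_sum) (use that in auto)
    also have "\<dots> \<le> (\<Sum>I\<in>Poly_Mapping.keys q \<union> Poly_Mapping.keys (p * q). \<Sum>j\<in>{1..d}. Poly_Mapping.lookup I j)"
      by (rule member_le_sum[of I _ "\<lambda>I. \<Sum>j\<in>{1..d}. Poly_Mapping.lookup I j"]) (use that in auto)
    finally show ?thesis by (simp add: N_def)
  qed
  have "real N ^ d * (\<Sum>I\<in>Poly_Mapping.keys (p * q). (cmod (Poly_Mapping.lookup (p * q) I))\<^sup>2) =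
      (\<Sum>n\<in>grid d N. (cmod (eval_poly d (grid_point N n) (p * q)))\<^sup>2)"
    by (rule parseval[symmetric]) (use N polys_mult[OF p q] in auto)
  also have "\<dots> \<le> (\<Sum>n\<in>grid d N. c\<^sup>2 * (cmod (eval_poly d (grid_point N n) q))\<^sup>2)"
    unfolding eval_poly_mult norm_mult power_mult_distrib
    by (intro sum_mono mult_right_mono power_mono bound) (auto simp: grid_point_def)
  also have "\<dots> = c\<^sup>2 * (real N ^ d * (\<Sum>I\<in>Poly_Mapping.keys q. (cmod (Poly_Mapping.lookup q I))\<^sup>2))"
    unfolding sum_distrib_left[symmetric]
    by (subst parseval[OF q]) (use N in auto)
  finally have "real N ^ d * (\<Sum>I\<in>Poly_Mapping.keys (p * q). (cmod (Poly_Mapping.lookup (p * q) I))\<^sup>2)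
      \<le> real N ^ d * (c\<^sup>2 * (\<Sum>I\<in>Poly_Mapping.keys q. (cmod (Poly_Mapping.lookup q I))\<^sup>2))"
    by (simp add: mult_ac)
  then show ?thesis
    by (rule mult_left_le_imp_le) (simp add: N_def del: of_nat_Suc)
qed

text \<open>
  The part of \<open>q\<close> outside a down-closed set \<open>D\<close> contributes nothing to \<open>p * q\<close> on \<open>D\<close>, so \<open>q\<close> may be
  replaced by its restriction to \<open>D\<close>.
\<close>
lemma mult_l2_bound_down_set:
  assumes p: "p \<in> polys d" and q: "q \<in> polys d" and c: "c \<ge> 0"
    and bound: "\<And>z. (\<And>j. j \<in> {1..d} \<Longrightarrow> cmod (z j) = 1) \<Longrightarrow> cmod (eval_poly d z p) \<le> c"
    and down: "\<And>I J. I \<in> multi_indices d \<Longrightarrow> J \<in> multi_indices d \<Longrightarrow> I + J \<in> D \<Longrightarrow> J \<in> D"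
  shows "(\<Sum>I\<in>Poly_Mapping.keys (p * q) \<inter> D. (cmod (Poly_Mapping.lookup (p * q) I))\<^sup>2) \<le>
    c\<^sup>2 * (\<Sum>I\<in>Poly_Mapping.keys q \<inter> D. (cmod (Poly_Mapping.lookup q I))\<^sup>2)"
proof -
  define part where "part E = (\<Sum>J\<in>Poly_Mapping.keys q \<inter> E. Poly_Mapping.single J (Poly_Mapping.lookup q J))" for E
  have lookup_part: "Poly_Mapping.lookup (part E) K = (if K \<in> E then Poly_Mapping.lookup q K else 0)" for E K
  proof -
    have "Poly_Mapping.lookup (part E) K =
        (\<Sum>J\<in>Poly_Mapping.keys q \<inter> E. if J = K then Poly_Mapping.lookup q J else 0)"
      unfolding part_def lookup_sum by (rule sum.cong) (auto simp: lookup_single when_def)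
    then show ?thesis by (auto simp: in_keys_iff)
  qed
  have keys_part: "Poly_Mapping.keys (part E) = Poly_Mapping.keys q \<inter> E" for E
    by (auto simp: in_keys_iff lookup_part split: if_splits)
  have part_polys: "part E \<in> polys d" for E
    using q by (auto simp: polys_def keys_part)
  have split: "q = part D + part (- D)"
    by (rule poly_mapping_eqI) (simp add: lookup_add lookup_part)
  have "K \<notin> D" if K: "K \<in> Poly_Mapping.keys (p * part (- D))" for K
  proof -
    obtain I J where IJ: "K = I + J" "I \<in> Poly_Mapping.keys p" "J \<in> Poly_Mapping.keys q" "J \<notin> D"
      using K keys_mult[of p "part (- D)"] unfolding keys_part by blast
    then show ?thesis using down[of I J] p q by (auto simp: polys_def)
  qed
  then have "Poly_Mapping.lookup (p * part (- D)) K = 0" if "K \<in> D" for K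
    using that by (auto simp: in_keys_iff)
  then have same: "Poly_Mapping.lookup (p * q) K = Poly_Mapping.lookup (p * part D) K" if "K \<in> D" for K
    using that by (subst split) (simp add: distrib_left lookup_add)
  have "(\<Sum>I\<in>Poly_Mapping.keys (p * q) \<inter> D. (cmod (Poly_Mapping.lookup (p * q) I))\<^sup>2)
      = (\<Sum>I\<in>Poly_Mapping.keys (p * part D) \<inter> D. (cmod (Poly_Mapping.lookup (p * part D) I))\<^sup>2)"
    by (rule sum.cong) (auto simp: in_keys_iff same)
  also have "\<dots> \<le> (\<Sum>I\<in>Poly_Mapping.keys (p * part D). (cmod (Poly_Mapping.lookup (p * part D) I))\<^sup>2)"
    by (rule sum_mono2) auto
  also have "\<dots> \<le> c\<^sup>2 * (\<Sum>I\<in>Poly_Mapping.keys (part D). (cmod (Poly_Mapping.lookup (part D) I))\<^sup>2)"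
    by (rule mult_l2_bound[OF p part_polys c bound])
  finally show ?thesis by (simp add: keys_part lookup_part)
qed

text \<open>
  A finite form of the layer-cake principle: a positive weight \<open>b\<close> is a combination, with positive
  coefficients, of the indicator functions of its superlevel sets. The induction subtracts the
  minimum \<open>m\<close> of \<open>b\<close>, the lowest layer, and drops the indices where nothing is left.
\<close>
lemma sum_weighted_nonneg_by_layers:
  fixes h b :: "'i \<Rightarrow> real"
  assumes "finite F" "\<And>i. i \<in> F \<Longrightarrow> b i > 0"
    and "\<And>t. t \<ge> 0 \<Longrightarrow> (\<Sum>i\<in>{i\<in>F. b i > t}. h i) \<ge> 0"
  shows "(\<Sum>i\<in>F. h i * b i) \<ge> 0"
  using assms
proof (induction "card F" arbitrary: F b rule: less_induct)
  case less
  show ?case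
  proof (cases "F = {}")
    case False
    define m where "m = Min (b ` F)"
    define F' where "F' = {i\<in>F. b i > m}"
    have m: "m \<in> b ` F" "\<And>i. i \<in> F \<Longrightarrow> m \<le> b i"
      using less.prems(1) False by (auto simp: m_def)
    then have "m > 0" using less.prems(2) by auto
    have sub: "F' \<subset> F" using m by (auto simp: F'_def)
    have IH: "(\<Sum>i\<in>F'. h i * (b i - m)) \<ge> 0"
    proof (rule less.hyps)
      show "card F' < card F" using sub less.prems(1) by (rule psubset_card_mono[rotated])
      show "finite F'" using less.prems(1) by (simp add: F'_def)
      show "b i - m > 0" if "i \<in> F'" for i using that by (simp add: F'_def)
      show "(\<Sum>i\<in>{i\<in>F'. b i - m > t}. h i) \<ge> 0" if "t \<ge> 0" for t
      proof -
        have "{i\<in>F'. b i - m > t} = {i\<in>F. b i > t + m}" using that by (auto simp: F'_def)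
        then show ?thesis using less.prems(3)[of "t + m"] that \<open>m > 0\<close> by simp
      qed
    qed
    have "{i\<in>F. b i > 0} = F" using less.prems(2) by auto
    then have "m * (\<Sum>i\<in>F. h i) \<ge> 0" using less.prems(3)[of 0] \<open>m > 0\<close> by simp
    moreover have "(\<Sum>i\<in>F. h i * b i) = m * (\<Sum>i\<in>F. h i) + (\<Sum>i\<in>F. h i * (b i - m))"
      by (simp add: sum_distrib_left sum.distrib[symmetric] algebra_simps)
    moreover have "(\<Sum>i\<in>F. h i * (b i - m)) = (\<Sum>i\<in>F'. h i * (b i - m))"
      by (rule sum.mono_neutral_right) (use less.prems(1) m(2) in \<open>force simp: F'_def\<close>)+
    ultimately show ?thesis using IH by simp
  qed simp
qed

text \<open>
  Superlevel sets of a decreasing weight are down-closed, so the estimate holds on every layer of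
  the weight.
\<close>
lemma mult_weighted_l2_bound:
  assumes p: "p \<in> polys d" and q: "q \<in> polys d" and c: "c \<ge> 0"
    and bound: "\<And>z. (\<And>j. j \<in> {1..d} \<Longrightarrow> cmod (z j) = 1) \<Longrightarrow> cmod (eval_poly d z p) \<le> c"
    and pos: "\<And>I. I \<in> multi_indices d \<Longrightarrow> \<beta> I > 0"
    and decreasing: "\<And>I J. I \<in> multi_indices d \<Longrightarrow> J \<in> multi_indices d \<Longrightarrow> \<beta> (I + J) \<le> \<beta> J"
  shows "(\<Sum>I\<in>Poly_Mapping.keys (p * q). (cmod (Poly_Mapping.lookup (p * q) I))\<^sup>2 * \<beta> I) \<le>
    c\<^sup>2 * (\<Sum>I\<in>Poly_Mapping.keys q. (cmod (Poly_Mapping.lookup q I))\<^sup>2 * \<beta> I)"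
proof -
  define F where "F = Poly_Mapping.keys q \<union> Poly_Mapping.keys (p * q)"
  define h where "h I = c\<^sup>2 * (cmod (Poly_Mapping.lookup q I))\<^sup>2 - (cmod (Poly_Mapping.lookup (p * q) I))\<^sup>2" for I
  have fin: "finite F" by (simp add: F_def)
  have F: "F \<subseteq> multi_indices d"
    using q polys_mult[OF p q] by (auto simp: F_def polys_def)
  have q_sum: "(\<Sum>I\<in>F \<inter> D. (cmod (Poly_Mapping.lookup q I))\<^sup>2 * g I) =
      (\<Sum>I\<in>Poly_Mapping.keys q \<inter> D. (cmod (Poly_Mapping.lookup q I))\<^sup>2 * g I)" for D g
    by (rule sum.mono_neutral_right) (auto simp: F_def in_keys_iff)
  have pq_sum: "(\<Sum>I\<in>F \<inter> D. (cmod (Poly_Mapping.lookup (p * q) I))\<^sup>2 * g I) =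
      (\<Sum>I\<in>Poly_Mapping.keys (p * q) \<inter> D. (cmod (Poly_Mapping.lookup (p * q) I))\<^sup>2 * g I)" for D g
    by (rule sum.mono_neutral_right) (auto simp: F_def in_keys_iff)
  have "(\<Sum>I\<in>F. h I * \<beta> I) \<ge> 0"
  proof (rule sum_weighted_nonneg_by_layers[OF fin])
    show "\<beta> I > 0" if "I \<in> F" for I using that F pos by auto
    fix t :: real
    define D where "D = {I \<in> multi_indices d. \<beta> I > t}"
    have "{I\<in>F. \<beta> I > t} = F \<inter> D" using F by (auto simp: D_def)
    then have "(\<Sum>I\<in>{I\<in>F. \<beta> I > t}. h I) =
        c\<^sup>2 * (\<Sum>I\<in>Poly_Mapping.keys q \<inter> D. (cmod (Poly_Mapping.lookup q I))\<^sup>2) -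
        (\<Sum>I\<in>Poly_Mapping.keys (p * q) \<inter> D. (cmod (Poly_Mapping.lookup (p * q) I))\<^sup>2)"
      using q_sum[where D = D and g = "\<lambda>_. 1"] pq_sum[where D = D and g = "\<lambda>_. 1"]
      by (simp add: h_def sum_subtractf sum_distrib_left[symmetric])
    also have "\<dots> \<ge> 0"
    proof -
      have "J \<in> D" if "I \<in> multi_indices d" "J \<in> multi_indices d" "I + J \<in> D" for I J
        using that decreasing[of I J] by (auto simp: D_def)
      then show ?thesis using mult_l2_bound_down_set[OF p q c bound, of D] by simp
    qed
    finally show "(\<Sum>I\<in>{I\<in>F. \<beta> I > t}. h I) \<ge> 0" .
  qed
  moreover have "(\<Sum>I\<in>F. h I * \<beta> I) =
      c\<^sup>2 * (\<Sum>I\<in>Poly_Mapping.keys q. (cmod (Poly_Mapping.lookup q I))\<^sup>2 * \<beta> I) -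
      (\<Sum>I\<in>Poly_Mapping.keys (p * q). (cmod (Poly_Mapping.lookup (p * q) I))\<^sup>2 * \<beta> I)"
    using q_sum[where D = UNIV and g = \<beta>] pq_sum[where D = UNIV and g = \<beta>]
    by (simp add: h_def left_diff_distrib sum_subtractf sum_distrib_left[symmetric] mult.assoc)
  ultimately show ?thesis by simp
qed


section \<open>The Kaijser-Varopoulos polynomial on the torus\<close>

definition kaijser_varopoulos :: cpoly where
  "kaijser_varopoulos =
     Poly_Mapping.single (unit_index 1 + unit_index 1) 1 +
     Poly_Mapping.single (unit_index 2 + unit_index 2) 1 +
     Poly_Mapping.single (unit_index 3 + unit_index 3) 1 +
     Poly_Mapping.single (unit_index 1 + unit_index 2) (- 2) +
     Poly_Mapping.single (unit_index 1 + unit_index 3) (- 2) +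
     Poly_Mapping.single (unit_index 2 + unit_index 3) (- 2)"

lemma kaijser_varopoulos_polys: "d \<ge> 3 \<Longrightarrow> kaijser_varopoulos \<in> polys d"
  unfolding kaijser_varopoulos_def
  by (intro polys_add polys_single multi_indices_add unit_index_in) auto

lemma prod_unit_index:
  fixes z :: "nat \<Rightarrow> complex"
  assumes "a \<in> {1..d}"
  shows "(\<Prod>j\<in>{1..d}. z j ^ Poly_Mapping.lookup (unit_index a) j) = z a"
proof -
  have "(\<Prod>j\<in>{1..d}. z j ^ Poly_Mapping.lookup (unit_index a) j) = (\<Prod>j\<in>{1..d}. if j = a then z j else 1)"
    by (rule prod.cong) (auto simp: unit_index_def lookup_single when_def)
  then show ?thesis using assms by simp
qed

lemma eval_kaijser_varopoulos:
  assumes "d \<ge> 3"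
  shows "eval_poly d z kaijser_varopoulos =
    (z 1)\<^sup>2 + (z 2)\<^sup>2 + (z 3)\<^sup>2 - 2 * z 1 * z 2 - 2 * z 1 * z 3 - 2 * z 2 * z 3"
proof -
  have "eval_poly d z (Poly_Mapping.single (unit_index a + unit_index b) c) = c * (z a * z b)"
    if "a \<in> {1..d}" "b \<in> {1..d}" for a b c
    unfolding eval_poly_single lookup_add power_add prod.distrib
    by (simp only: prod_unit_index that)
  then show ?thesis
    using assms by (simp add: kaijser_varopoulos_def eval_poly_add power2_eq_square)
qed

text \<open>
  With \<open>m = 4 - a\<^sup>2\<close>, the difference of the two sides is the quadratic form
  \<open>(m + 2) a\<^sup>2 - 4 (m - 1) a c + 4 m c\<^sup>2\<close> in \<open>a\<close> and \<open>c\<close>. Its discriminant is a positive multiple of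
  \<open>1 - 4 m\<close>, so it is nonnegative for \<open>m \<ge> 1/4\<close>; for smaller \<open>m\<close> the first term is at least 8, which
  outweighs the mixed term because \<open>|a c| \<le> 2\<close>.
\<close>
lemma real_product_bound:
  fixes a c :: real
  assumes "\<bar>a\<bar> \<le> 2" "\<bar>c\<bar> \<le> 1"
  shows "((a - 2)\<^sup>2 + 1 - 2 * (a - 2) * c) * ((a + 2)\<^sup>2 + 1 - 2 * (a + 2) * c) \<le> 25"
proof -
  define m where "m = 4 - a\<^sup>2"
  have "a\<^sup>2 \<le> 2\<^sup>2" using assms(1) by (rule power2_le_iff_abs_le[THEN iffD2, rotated]) simp
  then have m: "0 \<le> m" "m \<le> 4" by (simp_all add: m_def)
  have c: "c\<^sup>2 \<le> 1" using assms(2) by (simp add: abs_square_le_1)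
  have eq: "25 - ((a - 2)\<^sup>2 + 1 - 2 * (a - 2) * c) * ((a + 2)\<^sup>2 + 1 - 2 * (a + 2) * c)
      = (m + 2) * a\<^sup>2 - 4 * (m - 1) * (a * c) + 4 * m * c\<^sup>2"
    unfolding m_def by (simp add: power2_eq_square algebra_simps)
  have "(m + 2) * a\<^sup>2 - 4 * (m - 1) * (a * c) + 4 * m * c\<^sup>2 \<ge> 0"
  proof (cases "m \<ge> 1 / 4")
    case True
    have "(m + 2) * ((m + 2) * a\<^sup>2 - 4 * (m - 1) * (a * c) + 4 * m * c\<^sup>2)
        = ((m + 2) * a - 2 * (m - 1) * c)\<^sup>2 + 4 * (4 * m - 1) * c\<^sup>2"
      by (simp add: power2_eq_square algebra_simps)
    also have "\<dots> \<ge> 0" using True by simp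
    finally show ?thesis using m by (simp add: zero_le_mult_iff)
  next
    case False
    have "\<bar>a * c\<bar> \<le> 2 * 1" unfolding abs_mult by (rule mult_mono) (use assms in auto)
    moreover have "\<bar>m - 1\<bar> \<le> 1" using False m by auto
    ultimately have "\<bar>(m - 1) * (a * c)\<bar> \<le> 1 * 2" unfolding abs_mult[of "m - 1"]
      by (intro mult_mono) auto
    moreover have "(m + 2) * a\<^sup>2 = 8 + m * (2 - m)" by (simp add: m_def algebra_simps power2_eq_square)
    moreover have "m * (2 - m) \<ge> 0" "m * c\<^sup>2 \<ge> 0" using False m by auto
    ultimately show ?thesis by linarith
  qed
  then show ?thesis using eq by linarith
qed

text \<open>
  The polynomial is \<open>(u + v - w)\<^sup>2 - 4 u v\<close>. After division by a square root \<open>cis m\<close> of \<open>u v\<close> the sum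
  \<open>u + v\<close> becomes a real number \<open>a\<close> in \<open>[-2, 2]\<close>, and the polynomial factors as
  \<open>(a - w' - 2) (a - w' + 2)\<close> with \<open>|w'| = 1\<close>.
\<close>
lemma kaijser_varopoulos_torus_bound:
  fixes u v w :: complex
  assumes "cmod u = 1" "cmod v = 1" "cmod w = 1"
  shows "cmod (u\<^sup>2 + v\<^sup>2 + w\<^sup>2 - 2 * u * v - 2 * u * w - 2 * v * w) \<le> 5"
proof -
  have polar: "\<exists>\<theta>. z = cis \<theta>" if "cmod z = 1" for z
    using that cis_Arg[of z] by (metis norm_zero sgn_eq zero_neq_one div_by_1 of_real_1)
  obtain \<alpha> \<beta> \<gamma> where angles: "u = cis \<alpha>" "v = cis \<beta>" "w = cis \<gamma>"
    using polar assms by metis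
  define m where "m = (\<alpha> + \<beta>) / 2"
  define s where "s = (\<alpha> - \<beta>) / 2"
  define \<phi> where "\<phi> = \<gamma> - m"
  define a where "a = 2 * cos s"
  have u: "u = cis m * cis s" and v: "v = cis m * cis (- s)" and w: "w = cis m * cis \<phi>"
    by (simp_all add: angles m_def s_def \<phi>_def cis_mult field_simps)
  have sum: "u + v = cis m * complex_of_real a"
    by (simp add: u v a_def complex_eq_iff algebra_simps)
  have prod: "u * v = (cis m)\<^sup>2"
    by (simp add: u v power2_eq_square cis_mult)
  have "u\<^sup>2 + v\<^sup>2 + w\<^sup>2 - 2 * u * v - 2 * u * w - 2 * v * w = (u + v - w)\<^sup>2 - 4 * (u * v)"
    by (simp add: power2_eq_square algebra_simps)
  also have "\<dots> = (cis m)\<^sup>2 * ((complex_of_real a - cis \<phi> - 2) * (complex_of_real a - cis \<phi> + 2))"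
    unfolding sum prod w by (simp add: power2_eq_square algebra_simps)
  finally have "(cmod (u\<^sup>2 + v\<^sup>2 + w\<^sup>2 - 2 * u * v - 2 * u * w - 2 * v * w))\<^sup>2 =
      (cmod (complex_of_real a - cis \<phi> - 2))\<^sup>2 * (cmod (complex_of_real a - cis \<phi> + 2))\<^sup>2"
    by (simp add: norm_mult norm_power power_mult_distrib)
  also have "(cmod (complex_of_real a - cis \<phi> - 2))\<^sup>2 = (a - 2)\<^sup>2 + 1 - 2 * (a - 2) * cos \<phi>"
    using sin_cos_squared_add[of \<phi>] unfolding cmod_power2
    by (simp add: power2_eq_square algebra_simps)
  also have "(cmod (complex_of_real a - cis \<phi> + 2))\<^sup>2 = (a + 2)\<^sup>2 + 1 - 2 * (a + 2) * cos \<phi>"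
    using sin_cos_squared_add[of \<phi>] unfolding cmod_power2
    by (simp add: power2_eq_square algebra_simps)
  also have "((a - 2)\<^sup>2 + 1 - 2 * (a - 2) * cos \<phi>) * ((a + 2)\<^sup>2 + 1 - 2 * (a + 2) * cos \<phi>) \<le> 25"
    by (rule real_product_bound) (simp_all add: a_def abs_mult)
  finally have "(cmod (u\<^sup>2 + v\<^sup>2 + w\<^sup>2 - 2 * u * v - 2 * u * w - 2 * v * w))\<^sup>2 \<le> 5\<^sup>2"
    by simp
  then show ?thesis by (rule power2_le_imp_le) simp
qed


section \<open>Hilbert spaces and bounded operators\<close>

context complex_hilbert_space
begin

lemma scalar_ring_simps:
  "carrier (ring_of_type_algebra :: complex ring) = UNIV"
  "\<zero>\<^bsub>(ring_of_type_algebra :: complex ring)\<^esub> = 0"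
  "\<one>\<^bsub>(ring_of_type_algebra :: complex ring)\<^esub> = 1"
  "a \<oplus>\<^bsub>(ring_of_type_algebra :: complex ring)\<^esub> b = a + b"
  "a \<otimes>\<^bsub>(ring_of_type_algebra :: complex ring)\<^esub> b = a * b"
  by (simp_all add: ring_of_type_algebra_def)

lemmas smult_facts =
  smult_closed[unfolded scalar_ring_simps, OF UNIV_I]
  smult_l_distr[unfolded scalar_ring_simps, OF UNIV_I UNIV_I]
  smult_r_distr[unfolded scalar_ring_simps, OF UNIV_I]
  smult_assoc1[unfolded scalar_ring_simps, OF UNIV_I UNIV_I]
  smult_one[unfolded scalar_ring_simps]
  smult_l_null[unfolded scalar_ring_simps]

lemma smult_mem [simp, intro]: "x \<in> carrier H \<Longrightarrow> c \<odot>\<^bsub>H\<^esub> x \<in> carrier H"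
  by (rule smult_facts)

lemma uminus_eq_smult: "x \<in> carrier H \<Longrightarrow> \<ominus>\<^bsub>H\<^esub> x = (- 1) \<odot>\<^bsub>H\<^esub> x"
  by (rule M.minus_equality) (use smult_facts(2)[of x "- 1" 1] in \<open>simp_all add: smult_facts\<close>)

lemma cinner_add_right:
  "\<lbrakk>x \<in> carrier H; y \<in> carrier H; z \<in> carrier H\<rbrakk>
    \<Longrightarrow> cinner H x (y \<oplus>\<^bsub>H\<^esub> z) = cinner H x y + cinner H x z"
  using cinner_commute[of x] cinner_add_left[of y z x] by simp

lemma cinner_smult_right:
  "\<lbrakk>x \<in> carrier H; y \<in> carrier H\<rbrakk> \<Longrightarrow> cinner H x (c \<odot>\<^bsub>H\<^esub> y) = cnj c * cinner H x y"
  using cinner_commute[of x] cinner_smult_left[of y x c] by simp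

lemma cinner_zero_left: "x \<in> carrier H \<Longrightarrow> cinner H \<zero>\<^bsub>H\<^esub> x = 0"
  using cinner_add_left[of "\<zero>\<^bsub>H\<^esub>" "\<zero>\<^bsub>H\<^esub>" x] by simp

lemma cinner_self_nonneg: "x \<in> carrier H \<Longrightarrow> Re (cinner H x x) \<ge> 0"
  using cinner_pos[of x] cinner_zero_left[of x] by (cases "x = \<zero>\<^bsub>H\<^esub>") auto

lemma hnorm_nonneg: "x \<in> carrier H \<Longrightarrow> hnorm H x \<ge> 0"
  by (simp add: hnorm_def cinner_self_nonneg)

lemma hnorm_eq_0_iff: "x \<in> carrier H \<Longrightarrow> hnorm H x = 0 \<longleftrightarrow> x = \<zero>\<^bsub>H\<^esub>"
  using cinner_pos[of x] cinner_zero_left[of x]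
  by (cases "x = \<zero>\<^bsub>H\<^esub>") (auto simp: hnorm_def)

lemma hnorm_zero [simp]: "hnorm H \<zero>\<^bsub>H\<^esub> = 0"
  by (simp add: hnorm_eq_0_iff)

lemma cinner_self: "x \<in> carrier H \<Longrightarrow> cinner H x x = complex_of_real ((hnorm H x)\<^sup>2)"
  using cinner_commute[of x x] cinner_self_nonneg[of x]
  by (simp add: hnorm_def complex_eq_iff)

lemma hnorm_smult: "x \<in> carrier H \<Longrightarrow> hnorm H (c \<odot>\<^bsub>H\<^esub> x) = cmod c * hnorm H x"
proof -
  assume x: "x \<in> carrier H"
  have "cinner H (c \<odot>\<^bsub>H\<^esub> x) (c \<odot>\<^bsub>H\<^esub> x) = (c * cnj c) * cinner H x x"
    using x by (simp add: cinner_smult_left cinner_smult_right)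
  also have "\<dots> = complex_of_real ((cmod c)\<^sup>2 * (hnorm H x)\<^sup>2)"
    unfolding complex_norm_square[symmetric] using x by (simp add: cinner_self)
  finally show ?thesis
    using x hnorm_nonneg[OF x] by (simp add: hnorm_def[of H "c \<odot>\<^bsub>H\<^esub> x"] real_sqrt_mult)
qed

lemma cauchy_schwarz:
  assumes x: "x \<in> carrier H" and y: "y \<in> carrier H"
  shows "cmod (cinner H x y) \<le> hnorm H x * hnorm H y"
proof (cases "y = \<zero>\<^bsub>H\<^esub>")
  case True
  then show ?thesis
    using x y cinner_commute[of x y] cinner_zero_left[of x] by (simp add: hnorm_def cinner_zero_left)
next
  case False
  define n where "n = (hnorm H y)\<^sup>2"
  have n: "n > 0" using False y by (simp add: n_def hnorm_eq_0_iff)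
  (* u is the component of x orthogonal to y; its norm being nonnegative is the claim. *)
  define t where "t = cinner H x y / complex_of_real n"
  define u where "u = x \<oplus>\<^bsub>H\<^esub> (- t) \<odot>\<^bsub>H\<^esub> y"
  have "cinner H u u = cinner H x x - cnj t * cinner H x y - t * cinner H y x + t * cnj t * cinner H y y"
    using x y by (simp add: u_def cinner_add_left cinner_add_right cinner_smult_left
        cinner_smult_right algebra_simps)
  also have "cinner H y x = cnj (cinner H x y)" using x y by (rule cinner_commute[rotated])
  also have "cinner H y y = complex_of_real n" using y by (simp add: cinner_self n_def)
  also have "cinner H x x - cnj t * cinner H x y - t * cnj (cinner H x y) + t * cnj t * complex_of_real n
      = cinner H x x - cinner H x y * cnj (cinner H x y) / complex_of_real n"
    using n by (simp add: t_def)
  also have "\<dots> = complex_of_real ((hnorm H x)\<^sup>2 - (cmod (cinner H x y))\<^sup>2 / n)"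
    unfolding complex_norm_square[symmetric] using x by (simp add: cinner_self)
  finally have "cinner H u u = complex_of_real ((hnorm H x)\<^sup>2 - (cmod (cinner H x y))\<^sup>2 / n)" .
  moreover have "Re (cinner H u u) \<ge> 0" by (rule cinner_self_nonneg) (use x y in \<open>simp add: u_def\<close>)
  ultimately have "(cmod (cinner H x y))\<^sup>2 / n \<le> (hnorm H x)\<^sup>2" by simp
  then have "(cmod (cinner H x y))\<^sup>2 \<le> (hnorm H x * hnorm H y)\<^sup>2"
    using n by (simp add: n_def field_simps power_mult_distrib)
  then show ?thesis
    by (rule power2_le_imp_le) (use x y hnorm_nonneg in simp)
qed

lemma hnorm_triangle:
  assumes x: "x \<in> carrier H" and y: "y \<in> carrier H"
  shows "hnorm H (x \<oplus>\<^bsub>H\<^esub> y) \<le> hnorm H x + hnorm H y"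
proof (rule power2_le_imp_le)
  have "(hnorm H (x \<oplus>\<^bsub>H\<^esub> y))\<^sup>2 = Re (cinner H (x \<oplus>\<^bsub>H\<^esub> y) (x \<oplus>\<^bsub>H\<^esub> y))"
    using x y by (simp add: cinner_self)
  also have "\<dots> = Re (cinner H x x) + 2 * Re (cinner H x y) + Re (cinner H y y)"
    using x y cinner_commute[of y x]
    by (simp add: cinner_add_left cinner_add_right)
  also have "\<dots> = (hnorm H x)\<^sup>2 + 2 * Re (cinner H x y) + (hnorm H y)\<^sup>2"
    using x y by (simp add: cinner_self)
  also have "\<dots> \<le> (hnorm H x)\<^sup>2 + 2 * (hnorm H x * hnorm H y) + (hnorm H y)\<^sup>2"
    using cauchy_schwarz[OF x y] complex_Re_le_cmod[of "cinner H x y"] by simp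
  finally show "(hnorm H (x \<oplus>\<^bsub>H\<^esub> y))\<^sup>2 \<le> (hnorm H x + hnorm H y)\<^sup>2"
    by (simp add: power2_sum algebra_simps)
  show "hnorm H x + hnorm H y \<ge> 0" using x y by (simp add: hnorm_nonneg)
qed

lemma hnorm_finsum:
  assumes "finite A" "\<And>i. i \<in> A \<Longrightarrow> f i \<in> carrier H"
  shows "hnorm H (\<Oplus>\<^bsub>H\<^esub>i\<in>A. f i) \<le> (\<Sum>i\<in>A. hnorm H (f i))"
  using assms
proof (induction A rule: finite_induct)
  case empty
  then show ?case using hnorm_eq_0_iff[of "\<zero>\<^bsub>H\<^esub>"] by simp
next
  case (insert a A)
  then have "f \<in> A \<rightarrow> carrier H" "f a \<in> carrier H" by auto
  then show ?case
    using insert hnorm_triangle[of "f a" "\<Oplus>\<^bsub>H\<^esub>i\<in>A. f i"] by (simp add: M.finsum_insert)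
qed

lemma cinner_finsum_left:
  assumes "finite A" "\<And>i. i \<in> A \<Longrightarrow> f i \<in> carrier H" "y \<in> carrier H"
  shows "cinner H (\<Oplus>\<^bsub>H\<^esub>i\<in>A. f i) y = (\<Sum>i\<in>A. cinner H (f i) y)"
  using assms
proof (induction A rule: finite_induct)
  case empty
  then show ?case by (simp add: cinner_zero_left)
next
  case (insert a A)
  then have "f \<in> A \<rightarrow> carrier H" "f a \<in> carrier H" by auto
  then show ?case using insert by (simp add: M.finsum_insert cinner_add_left)
qed

text \<open>Pythagoras' theorem.\<close>
lemma hnorm_orthonormal_sum:
  assumes F: "finite F" "F \<subseteq> \<I>" and e: "orthonormal_basis H \<I> e"
  shows "(hnorm H (\<Oplus>\<^bsub>H\<^esub>i\<in>F. c i \<odot>\<^bsub>H\<^esub> e i))\<^sup>2 = (\<Sum>i\<in>F. (cmod (c i))\<^sup>2)"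
proof -
  let ?x = "\<Oplus>\<^bsub>H\<^esub>i\<in>F. c i \<odot>\<^bsub>H\<^esub> e i"
  have mem: "e i \<in> carrier H" if "i \<in> F" for i
    using that F e by (auto simp: orthonormal_basis_def)
  then have x: "?x \<in> carrier H" by (intro M.finsum_closed) auto
  have right: "cinner H (e i) ?x = cnj (c i)" if i: "i \<in> F" for i
  proof -
    have "cinner H ?x (e i) = (\<Sum>j\<in>F. c j * cinner H (e j) (e i))"
      using F mem i by (simp add: cinner_finsum_left cinner_smult_left)
    also have "\<dots> = (\<Sum>j\<in>F. if j = i then c j else 0)"
    proof (rule sum.cong)
      fix j assume "j \<in> F"
      then have "cinner H (e j) (e i) = (if j = i then 1 else 0)"
        using F i e unfolding orthonormal_basis_def by blast
      then show "c j * cinner H (e j) (e i) = (if j = i then c j else 0)" by simp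
    qed simp
    also have "\<dots> = c i" using F i by simp
    finally show ?thesis using cinner_commute[OF mem[OF i] x] by simp
  qed
  have "complex_of_real ((hnorm H ?x)\<^sup>2) = cinner H ?x ?x" using x by (simp add: cinner_self)
  also have "\<dots> = (\<Sum>i\<in>F. c i * cinner H (e i) ?x)"
    using F mem x by (simp add: cinner_finsum_left cinner_smult_left)
  also have "\<dots> = complex_of_real (\<Sum>i\<in>F. (cmod (c i))\<^sup>2)"
    unfolding of_real_sum complex_norm_square by (rule sum.cong) (simp_all add: right)
  finally show ?thesis by (simp only: of_real_eq_iff)
qed


lemma bounded_operator_closed: "A \<in> bounded_operators H \<Longrightarrow> x \<in> carrier H \<Longrightarrow> A x \<in> carrier H"
  by (simp add: bounded_operators_def)

lemma bounded_operator_add: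
  "A \<in> bounded_operators H \<Longrightarrow> x \<in> carrier H \<Longrightarrow> y \<in> carrier H \<Longrightarrow> A (x \<oplus>\<^bsub>H\<^esub> y) = A x \<oplus>\<^bsub>H\<^esub> A y"
  by (simp add: bounded_operators_def)

lemma bounded_operator_smult:
  "A \<in> bounded_operators H \<Longrightarrow> x \<in> carrier H \<Longrightarrow> A (c \<odot>\<^bsub>H\<^esub> x) = c \<odot>\<^bsub>H\<^esub> A x"
  by (simp add: bounded_operators_def)

lemma op_norm_le:
  assumes "C \<ge> 0" "\<And>x. x \<in> carrier H \<Longrightarrow> hnorm H (A x) \<le> C * hnorm H x"
  shows "op_norm H A \<le> C"
  unfolding op_norm_def
proof (rule cSUP_least)
  have "\<zero>\<^bsub>H\<^esub> \<in> {x \<in> carrier H. hnorm H x \<le> 1}" by simp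
  then show "{x \<in> carrier H. hnorm H x \<le> 1} \<noteq> {}" by blast
  fix x assume x: "x \<in> {x \<in> carrier H. hnorm H x \<le> 1}"
  then have "hnorm H (A x) \<le> C * hnorm H x" by (simp add: assms)
  also have "\<dots> \<le> C * 1" by (rule mult_left_mono) (use x assms in auto)
  finally show "hnorm H (A x) \<le> C" by simp
qed

lemma hnorm_le_op_norm:
  assumes C: "\<And>x. x \<in> carrier H \<Longrightarrow> hnorm H (A x) \<le> C * hnorm H x"
    and x: "x \<in> carrier H" "hnorm H x \<le> 1"
  shows "hnorm H (A x) \<le> op_norm H A"
  unfolding op_norm_def
proof (rule cSUP_upper)
  show "x \<in> {x \<in> carrier H. hnorm H x \<le> 1}" using x by simp
  show "bdd_above ((\<lambda>x. hnorm H (A x)) ` {x \<in> carrier H. hnorm H x \<le> 1})"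
  proof (rule bdd_aboveI2)
    fix x assume x: "x \<in> {x \<in> carrier H. hnorm H x \<le> 1}"
    then have "hnorm H (A x) \<le> C * hnorm H x" by (simp add: C)
    also have "\<dots> \<le> \<bar>C\<bar> * 1"
      by (rule mult_mono) (use x hnorm_nonneg in auto)
    finally show "hnorm H (A x) \<le> \<bar>C\<bar>" by simp
  qed
qed

lemma op_norm_bound:
  assumes A: "A \<in> bounded_operators H" and x: "x \<in> carrier H"
  shows "hnorm H (A x) \<le> op_norm H A * hnorm H x"
proof (cases "x = \<zero>\<^bsub>H\<^esub>")
  case True
  obtain C where "hnorm H (A x) \<le> C * hnorm H x"
    using A x unfolding bounded_operators_def by blast
  then show ?thesis using True by simp
next
  case False
  define r where "r = hnorm H x"
  have r: "r > 0" using False x hnorm_nonneg[OF x] hnorm_eq_0_iff[OF x] by (simp add: r_def)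
  define y where "y = complex_of_real (1 / r) \<odot>\<^bsub>H\<^esub> x"
  obtain C where C: "\<And>x. x \<in> carrier H \<Longrightarrow> hnorm H (A x) \<le> C * hnorm H x"
    using A unfolding bounded_operators_def by blast
  have "hnorm H y = cmod (complex_of_real (1 / r)) * r"
    unfolding y_def r_def by (rule hnorm_smult[OF x])
  also have "\<dots> = 1" using r by (simp add: norm_divide)
  finally have "hnorm H (A y) \<le> op_norm H A"
    by (intro hnorm_le_op_norm[OF C]) (simp_all add: y_def x)
  moreover have "hnorm H (A y) = cmod (complex_of_real (1 / r)) * hnorm H (A x)"
    unfolding y_def bounded_operator_smult[OF A x]
    by (rule hnorm_smult[OF bounded_operator_closed[OF A x]])
  ultimately have "hnorm H (A x) / r \<le> op_norm H A" using r by (simp add: norm_divide)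
  then show ?thesis using r by (simp add: r_def field_simps)
qed

lemma contraction:
  assumes "commuting_contractions H d T" "j \<in> {1..d}" "x \<in> carrier H"
  shows "T j x \<in> carrier H" "hnorm H (T j x) \<le> hnorm H x"
proof -
  have T: "T j \<in> bounded_operators H" "op_norm H (T j) \<le> 1"
    using assms(1)[unfolded commuting_contractions_def, THEN conjunct1] assms(2) by blast+
  show "T j x \<in> carrier H" by (rule bounded_operator_closed[OF T(1) assms(3)])
  have "hnorm H (T j x) \<le> op_norm H (T j) * hnorm H x" by (rule op_norm_bound[OF T(1) assms(3)])
  also have "\<dots> \<le> 1 * hnorm H x" by (rule mult_right_mono) (use T assms hnorm_nonneg in auto)
  finally show "hnorm H (T j x) \<le> hnorm H x" by simp
qed

lemma monomial_op_contraction: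
  assumes T: "commuting_contractions H d T" and x: "x \<in> carrier H"
  shows "monomial_op d T I x \<in> carrier H \<and> hnorm H (monomial_op d T I x) \<le> hnorm H x"
proof -
  have pow: "(T j ^^ n) y \<in> carrier H \<and> hnorm H ((T j ^^ n) y) \<le> hnorm H x"
    if "j \<in> {1..d}" "y \<in> carrier H" "hnorm H y \<le> hnorm H x" for j n y
    using that
  proof (induction n)
    case (Suc n)
    then have IH: "(T j ^^ n) y \<in> carrier H" "hnorm H ((T j ^^ n) y) \<le> hnorm H x" by simp_all
    show ?case
      using contraction[OF T Suc.prems(1) IH(1)] IH(2) by simp
  qed simp
  have "foldr (\<lambda>j A. (T j ^^ Poly_Mapping.lookup I j) \<circ> A) xs id x \<in> carrier H \<and>
      hnorm H (foldr (\<lambda>j A. (T j ^^ Poly_Mapping.lookup I j) \<circ> A) xs id x) \<le> hnorm H x"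
    if "set xs \<subseteq> {1..d}" for xs
    using that
  proof (induction xs)
    case (Cons j xs)
    then have "j \<in> {1..d}" "set xs \<subseteq> {1..d}" by auto
    with Cons.IH show ?case by (simp add: pow)
  qed (use x in simp)
  from this[of "[1..<Suc d]"] show ?thesis
    unfolding monomial_op_def set_upt atLeastLessThanSuc_atLeastAtMost by blast
qed

text \<open>
  By definition the factor with the larger index acts first, so the case \<open>a > b\<close> rests on
  commutation.
\<close>
lemma monomial_op_unit_unit:
  assumes T: "commuting_contractions H d T" and ab: "a \<in> {1..d}" "b \<in> {1..d}" and x: "x \<in> carrier H"
  shows "monomial_op d T (unit_index a + unit_index b) x = T a (T b x)"
proof -
  have "\<forall>j\<in>{1..d}. \<forall>k\<in>{1..d}. \<forall>x\<in>carrier H. T j (T k x) = T k (T j x)"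
    using T unfolding commuting_contractions_def by (rule conjunct2)
  from this[THEN bspec, OF ab(2), THEN bspec, OF ab(1), THEN bspec, OF x]
  have comm: "T b (T a x) = T a (T b x)" .
  define f where "f = Poly_Mapping.lookup (unit_index a + unit_index b)"
  have f: "f j = (if a = j then 1 else 0) + (if b = j then 1 else 0)" for j
    by (simp add: f_def unit_index_def lookup_add lookup_single when_def)
  have "foldr (\<lambda>j A. (T j ^^ f j) \<circ> A) xs id x
      = (if a \<in> set xs then T a else id) ((if b \<in> set xs then T b else id) x)"
    if "distinct xs" for xs
    using that
  proof (induction xs)
    case (Cons j xs)
    define G where "G = foldr (\<lambda>j A. (T j ^^ f j) \<circ> A) xs id x"
    have G: "G = (if a \<in> set xs then T a else id) ((if b \<in> set xs then T b else id) x)"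
      unfolding G_def using Cons.prems by (intro Cons.IH) simp
    have j: "j \<notin> set xs" using Cons.prems by simp
    have "(T j ^^ f j) G = (if a \<in> set (j # xs) then T a else id) ((if b \<in> set (j # xs) then T b else id) x)"
    proof (cases "a = j")
      case True
      show ?thesis
      proof (cases "b = j")
        case b: True
        then show ?thesis unfolding G f using True j by (simp add: eval_nat_numeral)
      next
        case False
        then show ?thesis unfolding G f using True j by simp
      qed
    next
      case False
      show ?thesis
      proof (cases "b = j")
        case True
        then show ?thesis unfolding G f using False j comm by (cases "a \<in> set xs") simp_all
      next
        case b: False
        then show ?thesis unfolding G f using False by simp
      qed
    qed
    moreover have "foldr (\<lambda>j A. (T j ^^ f j) \<circ> A) (j # xs) id x = (T j ^^ f j) G"
      by (simp add: G_def)
    ultimately show ?case by (rule trans[rotated])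
  qed simp
  from this[OF distinct_upt, of 1 "Suc d"] show ?thesis
    using ab unfolding monomial_op_def f_def set_upt atLeastLessThanSuc_atLeastAtMost
    by (simp only: if_True)
qed

lemma monomial_op_unit:
  assumes a: "a \<in> {1..d}"
  shows "monomial_op d T (unit_index a) x = T a x"
proof -
  define f where "f = Poly_Mapping.lookup (unit_index a)"
  have f: "f j = (if a = j then 1 else 0)" for j
    by (simp add: f_def unit_index_def lookup_single when_def)
  have "foldr (\<lambda>j A. (T j ^^ f j) \<circ> A) xs id x = (if a \<in> set xs then T a else id) x"
    if "distinct xs" for xs
    using that
  proof (induction xs)
    case (Cons j xs)
    define G where "G = foldr (\<lambda>j A. (T j ^^ f j) \<circ> A) xs id x"
    have G: "G = (if a \<in> set xs then T a else id) x"
      unfolding G_def using Cons.prems by (intro Cons.IH) simp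
    have "(T j ^^ f j) G = (if a \<in> set (j # xs) then T a else id) x"
      unfolding G f using Cons.prems by (cases "a = j") simp_all
    moreover have "foldr (\<lambda>j A. (T j ^^ f j) \<circ> A) (j # xs) id x = (T j ^^ f j) G"
      by (simp add: G_def)
    ultimately show ?case by (rule trans[rotated])
  qed simp
  from this[OF distinct_upt, of 1 "Suc d"] show ?thesis
    using a unfolding monomial_op_def f_def set_upt atLeastLessThanSuc_atLeastAtMost
    by (simp only: if_True)
qed

lemma poly_op_closed:
  assumes "commuting_contractions H d T" "x \<in> carrier H"
  shows "poly_op H d T p x \<in> carrier H"
  unfolding poly_op_def using monomial_op_contraction[OF assms] by (intro M.finsum_closed) auto

lemma poly_op_bound:
  assumes T: "commuting_contractions H d T" and x: "x \<in> carrier H"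
  shows "hnorm H (poly_op H d T p x) \<le>
    (\<Sum>I\<in>Poly_Mapping.keys p. cmod (Poly_Mapping.lookup p I)) * hnorm H x"
proof -
  have "hnorm H (poly_op H d T p x) \<le>
      (\<Sum>I\<in>Poly_Mapping.keys p. hnorm H (Poly_Mapping.lookup p I \<odot>\<^bsub>H\<^esub> monomial_op d T I x))"
    unfolding poly_op_def
    by (rule hnorm_finsum) (use monomial_op_contraction[OF T x] in auto)
  also have "\<dots> \<le> (\<Sum>I\<in>Poly_Mapping.keys p. cmod (Poly_Mapping.lookup p I) * hnorm H x)"
    by (rule sum_mono) (use monomial_op_contraction[OF T x] in \<open>simp add: hnorm_smult mult_left_mono\<close>)
  finally show ?thesis by (simp add: sum_distrib_right)
qed

lemma poly_op_superset:
  assumes T: "commuting_contractions H d T" and x: "x \<in> carrier H"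
    and A: "finite A" "Poly_Mapping.keys p \<subseteq> A"
  shows "poly_op H d T p x = (\<Oplus>\<^bsub>H\<^esub>I\<in>A. Poly_Mapping.lookup p I \<odot>\<^bsub>H\<^esub> monomial_op d T I x)"
proof -
  have mem: "monomial_op d T I x \<in> carrier H" for I
    using monomial_op_contraction[OF T x] by simp
  show ?thesis
    unfolding poly_op_def
  proof (rule M.add.finprod_mono_neutral_cong_left)
    show "Poly_Mapping.lookup p I \<odot>\<^bsub>H\<^esub> monomial_op d T I x = \<zero>\<^bsub>H\<^esub>"
      if "I \<in> A - Poly_Mapping.keys p" for I
      using that smult_facts(6)[OF mem] by (simp add: in_keys_iff)
  qed (use A mem in auto)
qed

lemma poly_op_add:
  assumes T: "commuting_contractions H d T" and x: "x \<in> carrier H"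
  shows "poly_op H d T (p + q) x = poly_op H d T p x \<oplus>\<^bsub>H\<^esub> poly_op H d T q x"
proof -
  let ?A = "Poly_Mapping.keys p \<union> Poly_Mapping.keys q"
  have mem: "monomial_op d T I x \<in> carrier H" for I
    using monomial_op_contraction[OF T x] by simp
  have "poly_op H d T (p + q) x =
      (\<Oplus>\<^bsub>H\<^esub>I\<in>?A. Poly_Mapping.lookup p I \<odot>\<^bsub>H\<^esub> monomial_op d T I x \<oplus>\<^bsub>H\<^esub>
        Poly_Mapping.lookup q I \<odot>\<^bsub>H\<^esub> monomial_op d T I x)"
    using keys_add[of p q] mem
    by (simp add: poly_op_superset[OF T x, of ?A] lookup_add smult_facts(2))
  also have "\<dots> = poly_op H d T p x \<oplus>\<^bsub>H\<^esub> poly_op H d T q x"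
    using mem by (simp add: poly_op_superset[OF T x, of ?A] M.finsum_addf)
  finally show ?thesis .
qed

lemma poly_op_single:
  assumes T: "commuting_contractions H d T" and x: "x \<in> carrier H"
  shows "poly_op H d T (Poly_Mapping.single I c) x = c \<odot>\<^bsub>H\<^esub> monomial_op d T I x"
proof -
  have "monomial_op d T I x \<in> carrier H" using monomial_op_contraction[OF T x] by simp
  then show ?thesis
    by (subst poly_op_superset[OF T x, of "{I}"]) simp_all
qed

end


section \<open>A five-dimensional space inside the universe\<close>

type_synonym complex5 = "complex \<times> complex \<times> complex \<times> complex \<times> complex"

definition scale5 :: "complex \<Rightarrow> complex5 \<Rightarrow> complex5" where
  "scale5 c = (\<lambda>(a, x, y, z, b). (c * a, c * x, c * y, c * z, c * b))"

definition inner5 :: "complex5 \<Rightarrow> complex5 \<Rightarrow> complex" where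
  "inner5 = (\<lambda>(a, x, y, z, b) (a', x', y', z', b').
     a * cnj a' + x * cnj x' + y * cnj y' + z * cnj z' + b * cnj b')"

lemma norm_complex5: "(norm (a, x, y, z, b :: complex))\<^sup>2 =
    (cmod a)\<^sup>2 + (cmod x)\<^sup>2 + (cmod y)\<^sup>2 + (cmod z)\<^sup>2 + (cmod b)\<^sup>2" for a x y z :: complex
  by (simp add: norm_Pair)

lemma inner5_self: "inner5 v v = complex_of_real ((norm v)\<^sup>2)"
  by (cases v) (simp add: inner5_def norm_complex5 complex_norm_square flip: of_real_power)

text \<open>
  The image of \<open>\<complex>\<^sup>5\<close> under an injection \<open>\<phi>\<close>, with the structure carried over along \<open>\<phi>\<close>.
\<close>
definition transported_complex5 :: "(complex5 \<Rightarrow> 'u) \<Rightarrow> 'u inner_product_structure" where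
  "transported_complex5 \<phi> = \<lparr>
     carrier = range \<phi>, monoid.mult = (\<lambda>x y. \<phi> 0), one = \<phi> 0,
     zero = \<phi> 0, add = (\<lambda>x y. \<phi> (inv_into UNIV \<phi> x + inv_into UNIV \<phi> y)),
     smult = (\<lambda>c x. \<phi> (scale5 c (inv_into UNIV \<phi> x))),
     cinner = (\<lambda>x y. inner5 (inv_into UNIV \<phi> x) (inv_into UNIV \<phi> y))\<rparr>"

context
  fixes \<phi> :: "complex5 \<Rightarrow> 'u" and K :: "'u inner_product_structure"
  assumes inj: "inj \<phi>"
  defines "K \<equiv> transported_complex5 \<phi>"
begin

lemma transported_simps:
  "carrier K = range \<phi>" "\<zero>\<^bsub>K\<^esub> = \<phi> 0" "\<phi> u \<oplus>\<^bsub>K\<^esub> \<phi> v = \<phi> (u + v)"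
  "c \<odot>\<^bsub>K\<^esub> \<phi> u = \<phi> (scale5 c u)" "cinner K (\<phi> u) (\<phi> v) = inner5 u v" "hnorm K (\<phi> u) = norm u"
  using inj by (simp_all add: K_def transported_complex5_def hnorm_def inner5_self)

lemma transported_abelian_group: "abelian_group K"
proof (rule abelian_groupI)
  fix x assume "x \<in> carrier K"
  then obtain u where u: "x = \<phi> u" by (auto simp: transported_simps)
  show "\<exists>y\<in>carrier K. y \<oplus>\<^bsub>K\<^esub> x = \<zero>\<^bsub>K\<^esub>"
    by (rule bexI[of _ "\<phi> (- u)"]) (simp_all add: u transported_simps)
qed (auto simp: transported_simps add_ac)

lemma transported_minus: "\<phi> u \<ominus>\<^bsub>K\<^esub> \<phi> v = \<phi> (u - v)"
proof -
  interpret abelian_group K by (rule transported_abelian_group)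
  have "\<ominus>\<^bsub>K\<^esub> \<phi> v = \<phi> (- v)"
    by (rule minus_equality) (simp_all add: transported_simps)
  then show ?thesis by (simp add: a_minus_def transported_simps)
qed

lemma transported_hilbert_space: "complex_hilbert_space K"
proof (intro complex_hilbert_space.intro complex_hilbert_space_axioms.intro moduleI)
  show "cring (ring_of_type_algebra :: complex ring)" by (rule cring_from_type_algebra)
  show "abelian_group K" by (rule transported_abelian_group)
next
  fix s :: "nat \<Rightarrow> 'u"
  assume s: "\<And>n. s n \<in> carrier K"
    and cauchy: "\<And>e. e > 0 \<Longrightarrow> \<exists>N. \<forall>m\<ge>N. \<forall>n\<ge>N. hnorm K (s m \<ominus>\<^bsub>K\<^esub> s n) < e"
  define u where "u n = inv_into UNIV \<phi> (s n)" for n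
  have u: "s = (\<lambda>n. \<phi> (u n))"
    using s by (simp add: u_def transported_simps f_inv_into_f)
  have "Cauchy u"
    using cauchy by (simp add: u transported_minus transported_simps Cauchy_def dist_norm)
  then obtain v where "u \<longlonglongrightarrow> v" by (auto simp: Cauchy_convergent_iff convergent_def)
  then have "(\<lambda>n. hnorm K (s n \<ominus>\<^bsub>K\<^esub> \<phi> v)) \<longlonglongrightarrow> 0"
    by (simp add: u transported_minus transported_simps LIM_zero_iff tendsto_norm_zero)
  then show "\<exists>x\<in>carrier K. (\<lambda>n. hnorm K (s n \<ominus>\<^bsub>K\<^esub> x)) \<longlonglongrightarrow> 0"
    by (intro bexI[of _ "\<phi> v"]) (simp_all add: transported_simps)
next
  fix x assume x: "x \<in> carrier K" "x \<noteq> \<zero>\<^bsub>K\<^esub>"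
  then obtain u where "x = \<phi> u" "u \<noteq> 0" unfolding transported_simps by blast
  then show "Re (cinner K x x) > 0" by (simp add: transported_simps inner5_self)
qed (auto simp: transported_simps ring_of_type_algebra_def scale5_def inner5_def algebra_simps
    split: prod.splits)

end

text \<open>
  A nonzero vector \<open>v\<close> spans a copy of \<open>\<complex>\<close> in the universe, and \<open>\<complex>\<close> has as many elements as
  \<open>\<complex> \<times> \<complex>\<close>, hence as \<open>\<complex>\<^sup>5\<close>.
\<close>
lemma ex_inj_complex5:
  assumes "complex_hilbert_space (K :: 'u inner_product_structure)" "v \<in> carrier K" "v \<noteq> \<zero>\<^bsub>K\<^esub>"
  shows "\<exists>\<phi> :: complex5 \<Rightarrow> 'u. inj \<phi>"
proof -
  interpret complex_hilbert_space K by fact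
  have "infinite (UNIV :: complex set)" by (rule infinite_UNIV_char_0)
  then obtain f :: "complex \<times> complex \<Rightarrow> complex" where "bij_betw f (UNIV \<times> UNIV) UNIV"
    using card_of_Times_same_infinite unfolding card_of_ordIso[symmetric] by blast
  then have f: "inj f" by (simp add: bij_betw_def)
  have line: "inj (\<lambda>c. c \<odot>\<^bsub>K\<^esub> v)"
  proof (rule injI)
    fix c c' assume eq: "c \<odot>\<^bsub>K\<^esub> v = c' \<odot>\<^bsub>K\<^esub> v"
    have "c * cinner K v v = c' * cinner K v v"
      using arg_cong[OF eq, of "\<lambda>x. cinner K x v"] assms(2) by (simp add: cinner_smult_left)
    then show "c = c'" using cinner_pos[OF assms(2,3)] by auto
  qed
  have "inj (\<lambda>(a, x, y, z, b). f (a, f (x, f (y, f (z, b)))) \<odot>\<^bsub>K\<^esub> v)"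
    by (rule injI) (auto dest!: injD[OF line] injD[OF f])
  then show ?thesis by blast
qed


section \<open>Three commuting contractions violating von Neumann's inequality\<close>

definition inv_sqrt3 :: complex where
  "inv_sqrt3 = complex_of_real (1 / sqrt 3)"

lemma cmod_inv_sqrt3: "cmod inv_sqrt3 = 1 / sqrt 3"
  by (simp add: inv_sqrt3_def norm_divide)

text \<open>
  \<open>T\<^sub>j\<close> sends the first basis vector to the \<open>j\<close>-th of three middle ones, and the \<open>k\<close>-th middle one to
  \<open>M\<^sub>j\<^sub>k\<close> times the last, where \<open>M\<close> has entries \<open>1 / sqrt 3\<close> on and \<open>- 1 / sqrt 3\<close> off the diagonal. The
  operators commute because \<open>M\<close> is symmetric and are contractions because the rows of \<open>M\<close> are unit
  vectors. The signs of \<open>M\<close> are those of the coefficients of the Kaijser-Varopoulos polynomial,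
  so that all nine products add up without cancellation.
\<close>
definition kv_op :: "nat \<Rightarrow> complex5 \<Rightarrow> complex5" where
  "kv_op j = (\<lambda>(a, x, y, z, b).
     if j = 1 then (0, a, 0, 0, inv_sqrt3 * (x - y - z))
     else if j = 2 then (0, 0, a, 0, inv_sqrt3 * (y - x - z))
     else if j = 3 then (0, 0, 0, a, inv_sqrt3 * (z - x - y))
     else 0)"

lemma kv_op_add: "kv_op j (u + v) = kv_op j u + kv_op j v"
  by (cases u; cases v) (simp add: kv_op_def algebra_simps zero_prod_def)

lemma kv_op_scale: "kv_op j (scale5 c u) = scale5 c (kv_op j u)"
  by (cases u) (simp add: kv_op_def scale5_def algebra_simps zero_prod_def)

lemma kv_op_commute: "kv_op j (kv_op k u) = kv_op k (kv_op j u)"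
  by (cases u) (simp add: kv_op_def zero_prod_def)

lemma cmod_sum3_sq: "(cmod (inv_sqrt3 * (x - y - z)))\<^sup>2 \<le>
    (cmod x)\<^sup>2 + (cmod y)\<^sup>2 + (cmod z)\<^sup>2"
proof -
  have "(cmod (x - y - z))\<^sup>2 \<le> (cmod x + cmod y + cmod z)\<^sup>2"
    by (intro power_mono norm_ge_zero) (meson add_right_mono norm_triangle_ineq4 order_trans)
  also have "\<dots> \<le> 3 * ((cmod x)\<^sup>2 + (cmod y)\<^sup>2 + (cmod z)\<^sup>2)"
    using sum_squares_bound[of "cmod x" "cmod y"] sum_squares_bound[of "cmod x" "cmod z"]
      sum_squares_bound[of "cmod y" "cmod z"]
    by (simp add: power2_eq_square algebra_simps)
  finally show ?thesis by (simp add: norm_mult cmod_inv_sqrt3 power_divide)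
qed

lemma kv_op_contraction: "norm (kv_op j u) \<le> norm u"
proof (rule power2_le_imp_le)
  obtain a x y z b where u: "u = (a, x, y, z, b)" by (cases u)
  have "(norm (kv_op j u))\<^sup>2 \<le> (cmod a)\<^sup>2 + ((cmod x)\<^sup>2 + (cmod y)\<^sup>2 + (cmod z)\<^sup>2)"
    using cmod_sum3_sq[of x y z] cmod_sum3_sq[of y x z] cmod_sum3_sq[of z x y]
    by (simp add: u kv_op_def norm_Pair add_ac)
  also have "\<dots> \<le> (norm u)\<^sup>2" by (simp add: u norm_complex5)
  finally show "(norm (kv_op j u))\<^sup>2 \<le> (norm u)\<^sup>2" .
qed simp

definition transported_kv :: "(complex5 \<Rightarrow> 'u) \<Rightarrow> nat \<Rightarrow> 'u \<Rightarrow> 'u" where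
  "transported_kv \<phi> j x = \<phi> (kv_op j (inv_into UNIV \<phi> x))"

context
  fixes \<phi> :: "complex5 \<Rightarrow> 'u" and K :: "'u inner_product_structure" and d :: nat
  assumes inj: "inj \<phi>" and d: "d \<ge> 3"
  defines "K \<equiv> transported_complex5 \<phi>"
begin

lemmas K_simps = transported_simps[OF inj, folded K_def]

lemma transported_kv_apply: "transported_kv \<phi> j (\<phi> u) = \<phi> (kv_op j u)"
  using inj by (simp add: transported_kv_def)

lemma K_hilbert: "complex_hilbert_space K"
  unfolding K_def by (rule transported_hilbert_space[OF inj])

lemma transported_kv_commuting_contractions: "commuting_contractions K d (transported_kv \<phi>)"
proof -
  interpret complex_hilbert_space K by (rule K_hilbert)
  have bound: "hnorm K (transported_kv \<phi> j x) \<le> 1 * hnorm K x" if "x \<in> carrier K" for j x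
    using that kv_op_contraction by (auto simp: K_simps(1,6) transported_kv_apply)
  have "transported_kv \<phi> j \<in> bounded_operators K" for j
    unfolding bounded_operators_def
  proof (intro CollectI conjI exI[of _ 1])
    show "\<forall>x\<in>carrier K. hnorm K (transported_kv \<phi> j x) \<le> 1 * hnorm K x"
      using bound by blast
  qed (auto simp: K_simps transported_kv_apply kv_op_add kv_op_scale)
  moreover have "op_norm K (transported_kv \<phi> j) \<le> 1" for j
    by (rule op_norm_le[OF _ bound]) simp_all
  moreover have "transported_kv \<phi> j (transported_kv \<phi> k x) = transported_kv \<phi> k (transported_kv \<phi> j x)"
    if "x \<in> carrier K" for j k x
    using that kv_op_commute by (auto simp: K_simps(1) transported_kv_apply)
  ultimately show ?thesis unfolding commuting_contractions_def by simp
qed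

text \<open>
  The operator maps the first basis vector to \<open>9 / sqrt 3\<close> times the last.
\<close>
lemma op_norm_transported_kv: "op_norm K (poly_op K d (transported_kv \<phi>) kaijser_varopoulos) > 5"
proof -
  interpret complex_hilbert_space K by (rule K_hilbert)
  note T = transported_kv_commuting_contractions
  define e where "e = \<phi> (1, 0, 0, 0, 0)"
  have e: "e \<in> carrier K" "hnorm K e = 1"
    by (simp_all add: e_def K_simps norm_Pair)
  have single: "poly_op K d (transported_kv \<phi>) (Poly_Mapping.single (unit_index a + unit_index b) c) e
      = \<phi> (scale5 c (kv_op a (kv_op b (1, 0, 0, 0, 0))))" if "a \<in> {1..d}" "b \<in> {1..d}" for a b c
    unfolding poly_op_single[OF T e(1)] monomial_op_unit_unit[OF T that e(1)]
    by (simp add: e_def transported_kv_apply K_simps)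
  have "poly_op K d (transported_kv \<phi>) kaijser_varopoulos e =
      \<phi> (0, 0, 0, 0, 9 * inv_sqrt3)"
    unfolding kaijser_varopoulos_def poly_op_add[OF T e(1)]
    using d by (simp add: single K_simps kv_op_def scale5_def)
  then have "hnorm K (poly_op K d (transported_kv \<phi>) kaijser_varopoulos e) = 9 / sqrt 3"
    by (simp add: K_simps norm_Pair norm_mult cmod_inv_sqrt3)
  moreover have "hnorm K (poly_op K d (transported_kv \<phi>) kaijser_varopoulos e) \<le>
      op_norm K (poly_op K d (transported_kv \<phi>) kaijser_varopoulos)"
    by (rule hnorm_le_op_norm[OF poly_op_bound[OF T]]) (use e in simp_all)
  moreover have "9 / sqrt 3 > (5 :: real)"
  proof -
    have "sqrt 3 < 9 / 5" by (rule real_less_lsqrt) (simp_all add: power2_eq_square)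
    then show ?thesis by (simp add: field_simps)
  qed
  ultimately show ?thesis by linarith
qed

end


section \<open>The universal norm\<close>

text \<open>
  A supremum of reals dominates its elements only if the set is bounded; here the sum of the
  absolute values of the coefficients is a bound that is uniform in the tuple.
\<close>
lemma op_norm_le_universal_norm:
  fixes K :: "'u inner_product_structure"
  assumes "complex_hilbert_space K" "commuting_contractions K d T"
  shows "op_norm K (poly_op K d T p) \<le> universal_norm TYPE('u) d p"
  unfolding universal_norm_def
proof (rule cSup_upper)
  show "bdd_above {op_norm K (poly_op K d T p) | (K :: 'u inner_product_structure) T.
      complex_hilbert_space K \<and> commuting_contractions K d T}"
  proof (rule bdd_aboveI)
    fix r assume "r \<in> {op_norm K (poly_op K d T p) | (K :: 'u inner_product_structure) T.
      complex_hilbert_space K \<and> commuting_contractions K d T}"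
    then obtain K :: "'u inner_product_structure" and T
      where r: "r = op_norm K (poly_op K d T p)" "complex_hilbert_space K" "commuting_contractions K d T"
      by blast
    interpret complex_hilbert_space K by (rule r)
    show "r \<le> (\<Sum>I\<in>Poly_Mapping.keys p. cmod (Poly_Mapping.lookup p I))"
      unfolding r(1) by (rule op_norm_le[OF _ poly_op_bound[OF r(3)]]) (simp_all add: sum_nonneg)
  qed
qed (use assms in blast)

text \<open>
  The given tuple serves to make the supremum range over a nonempty set.
\<close>
lemma universal_norm_var_le_1:
  fixes K :: "'u inner_product_structure"
  assumes K: "complex_hilbert_space K" "commuting_contractions K d T" and j: "j \<in> {1..d}"
  shows "universal_norm TYPE('u) d (var_poly j) \<le> 1"
  unfolding universal_norm_def
proof (rule cSup_least)
  show "{op_norm K (poly_op K d T (var_poly j)) | (K :: 'u inner_product_structure) T.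
      complex_hilbert_space K \<and> commuting_contractions K d T} \<noteq> {}" using K by blast
  fix r assume "r \<in> {op_norm K (poly_op K d T (var_poly j)) | (K :: 'u inner_product_structure) T.
      complex_hilbert_space K \<and> commuting_contractions K d T}"
  then obtain K :: "'u inner_product_structure" and T
    where r: "r = op_norm K (poly_op K d T (var_poly j))" "complex_hilbert_space K" "commuting_contractions K d T"
    by blast
  interpret complex_hilbert_space K by (rule r)
  have "hnorm K (poly_op K d T (var_poly j) x) \<le> 1 * hnorm K x" if x: "x \<in> carrier K" for x
    using contraction[OF r(3) j x]
    by (simp add: var_poly_def poly_op_single[OF r(3) x] monomial_op_unit[OF j] smult_facts(5))
  then show "r \<le> 1" unfolding r(1) by (intro op_norm_le) simp_all
qed

text \<open>All operators on a zero space agree, so both suprema are taken over the same set.\<close>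
lemma universal_norm_trivial:
  assumes "\<And>(K :: 'u inner_product_structure) x. complex_hilbert_space K \<Longrightarrow> x \<in> carrier K \<Longrightarrow> x = \<zero>\<^bsub>K\<^esub>"
  shows "universal_norm TYPE('u) d p = universal_norm TYPE('u) d q"
proof -
  have eq: "op_norm K (poly_op K d T p) = op_norm K (poly_op K d T q)"
    if K: "complex_hilbert_space K" and T: "commuting_contractions K d T"
    for K :: "'u inner_product_structure" and T
  proof -
    interpret complex_hilbert_space K by (rule K)
    have "poly_op K d T p x = poly_op K d T q x" if "x \<in> carrier K" for x
      using assms[OF K] poly_op_closed[OF T that] by metis
    then show ?thesis unfolding op_norm_def by (intro SUP_cong) auto
  qed
  then have "{op_norm K (poly_op K d T p) | (K :: 'u inner_product_structure) T.
      complex_hilbert_space K \<and> commuting_contractions K d T} =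
    {op_norm K (poly_op K d T q) | (K :: 'u inner_product_structure) T.
      complex_hilbert_space K \<and> commuting_contractions K d T}"
    by (intro Collect_cong ex_cong1) auto
  then show ?thesis unfolding universal_norm_def by (rule arg_cong)
qed


section \<open>Von Neumann's inequality for contractive weighted shifts\<close>

text \<open>Every multi-index is reached from 0 by adding unit indices; induction on the total degree.\<close>
lemma multi_index_induct [consumes 1, case_names zero step]:
  assumes I: "I \<in> multi_indices d" and zero: "P 0"
    and step: "\<And>I j. I \<in> multi_indices d \<Longrightarrow> j \<in> {1..d} \<Longrightarrow> P I \<Longrightarrow> P (unit_index j + I)"
  shows "P I"
  using I
proof (induction "\<Sum>j\<in>{1..d}. Poly_Mapping.lookup I j" arbitrary: I rule: less_induct)
  case less
  show ?case
  proof (cases "I = 0")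
    case False
    then obtain j where j: "j \<in> Poly_Mapping.keys I" by (metis keys_eq_empty ex_in_conv)
    then have jd: "j \<in> {1..d}" using less.prems by (auto simp: multi_indices_def)
    define I' where "I' = I - unit_index j"
    have I': "Poly_Mapping.lookup I' k = Poly_Mapping.lookup I k - (if j = k then 1 else 0)" for k
      by (simp add: I'_def minus_poly_mapping.rep_eq unit_index_def lookup_single when_def)
    have eq: "I = unit_index j + I'"
      by (rule poly_mapping_eqI)
        (use j in \<open>auto simp: I' lookup_add unit_index_def lookup_single when_def in_keys_iff\<close>)
    have mem: "I' \<in> multi_indices d"
      using less.prems by (auto simp: multi_indices_def in_keys_iff I' subset_iff)
    have "(\<Sum>k\<in>{1..d}. Poly_Mapping.lookup I' k) < (\<Sum>k\<in>{1..d}. Poly_Mapping.lookup I k)"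
      by (rule sum_strict_mono_ex1) (use j jd in \<open>auto simp: I' in_keys_iff\<close>)
    then show ?thesis unfolding eq
      using less.hyps[OF _ mem] step[OF mem jd] by (simp add: eq[symmetric])
  qed (use zero in simp)
qed

text \<open>
  A representation of the polynomials in which the variables act as a weighted shift of
  contractions.
\<close>
locale shift_representation = complex_hilbert_space H
  for H :: "'a inner_product_structure" (structure) +
  fixes d :: nat and \<rho> :: "cpoly \<Rightarrow> 'a \<Rightarrow> 'a"
    and e :: "multi_index \<Rightarrow> 'a" and w :: "multi_index \<Rightarrow> nat \<Rightarrow> real"
  assumes rep_bounded: "p \<in> polys d \<Longrightarrow> \<rho> p \<in> bounded_operators H"
    and rep_add: "\<lbrakk>p \<in> polys d; q \<in> polys d; x \<in> carrier H\<rbrakk> \<Longrightarrow> \<rho> (p + q) x = \<rho> p x \<oplus>\<^bsub>H\<^esub> \<rho> q x"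
    and rep_smult: "\<lbrakk>p \<in> polys d; x \<in> carrier H\<rbrakk> \<Longrightarrow> \<rho> (const_poly c * p) x = c \<odot>\<^bsub>H\<^esub> \<rho> p x"
    and rep_mult: "\<lbrakk>p \<in> polys d; q \<in> polys d; x \<in> carrier H\<rbrakk> \<Longrightarrow> \<rho> (p * q) x = \<rho> p (\<rho> q x)"
    and rep_one: "x \<in> carrier H \<Longrightarrow> \<rho> 1 x = x"
    and basis: "orthonormal_basis H (multi_indices d) e"
    and w_pos: "\<lbrakk>I \<in> multi_indices d; j \<in> {1..d}\<rbrakk> \<Longrightarrow> w I j > 0"
    and shift: "\<lbrakk>I \<in> multi_indices d; j \<in> {1..d}\<rbrakk> \<Longrightarrow>
      \<rho> (var_poly j) (e I) = complex_of_real (w I j) \<odot>\<^bsub>H\<^esub> e (I + unit_index j)"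
    and contractive: "j \<in> {1..d} \<Longrightarrow> op_norm H (\<rho> (var_poly j)) \<le> 1"
begin

lemma rep_closed: "p \<in> polys d \<Longrightarrow> x \<in> carrier H \<Longrightarrow> \<rho> p x \<in> carrier H"
  by (rule bounded_operator_closed[OF rep_bounded])

lemma rep_zero: "x \<in> carrier H \<Longrightarrow> \<rho> 0 x = \<zero>\<^bsub>H\<^esub>"
  using rep_smult[OF polys_zero, of x 0] rep_closed[OF polys_zero, of x]
  by (simp add: smult_facts(6))

lemma rep_sum:
  assumes "finite F" "\<And>i. i \<in> F \<Longrightarrow> f i \<in> polys d" "x \<in> carrier H"
  shows "\<rho> (\<Sum>i\<in>F. f i) x = (\<Oplus>\<^bsub>H\<^esub>i\<in>F. \<rho> (f i) x)"
  using assms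
proof (induction F rule: finite_induct)
  case empty
  then show ?case by (simp add: rep_zero)
next
  case (insert a F)
  then have "(\<lambda>i. \<rho> (f i) x) \<in> F \<rightarrow> carrier H" "\<rho> (f a) x \<in> carrier H" by (auto intro: rep_closed)
  with insert show ?case by (simp add: M.finsum_insert rep_add polys_sum)
qed

lemma e_closed: "I \<in> multi_indices d \<Longrightarrow> e I \<in> carrier H"
  using basis by (simp add: orthonormal_basis_def)

lemma hnorm_e: "I \<in> multi_indices d \<Longrightarrow> hnorm H (e I) = 1"
  using basis by (simp add: orthonormal_basis_def hnorm_def)

lemma zero_index: "0 \<in> multi_indices d"
  by (simp add: multi_indices_def)

lemma var_poly_polys: "j \<in> {1..d} \<Longrightarrow> var_poly j \<in> polys d"
  unfolding var_poly_def by (intro polys_single unit_index_in)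

lemma rep_unit_monomial:
  assumes "j \<in> {1..d}" "I \<in> multi_indices d" "x \<in> carrier H"
  shows "\<rho> (Poly_Mapping.single (unit_index j + I) 1) x =
    \<rho> (var_poly j) (\<rho> (Poly_Mapping.single I 1) x)"
  using rep_mult[OF var_poly_polys polys_single, of j I x 1] assms
  by (simp add: var_poly_def mult_single)

lemma monomial_vacuum:
  assumes "I \<in> multi_indices d"
  shows "\<exists>b>0. \<rho> (Poly_Mapping.single I 1) (e 0) = complex_of_real b \<odot>\<^bsub>H\<^esub> e I"
  using assms
proof (induction rule: multi_index_induct)
  case zero
  show ?case
    by (rule exI[of _ 1]) (simp add: rep_one e_closed zero_index smult_facts(5))
next
  case (step I j)
  then obtain b where b: "b > 0" "\<rho> (Poly_Mapping.single I 1) (e 0) = complex_of_real b \<odot>\<^bsub>H\<^esub> e I"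
    by blast
  have mem: "unit_index j + I \<in> multi_indices d"
    using step by (intro multi_indices_add unit_index_in)
  have "\<rho> (Poly_Mapping.single (unit_index j + I) 1) (e 0) =
      complex_of_real b \<odot>\<^bsub>H\<^esub> (complex_of_real (w I j) \<odot>\<^bsub>H\<^esub> e (I + unit_index j))"
    using step by (simp add: rep_unit_monomial e_closed zero_index b
        bounded_operator_smult[OF rep_bounded[OF var_poly_polys]] shift)
  also have "\<dots> = complex_of_real (b * w I j) \<odot>\<^bsub>H\<^esub> e (unit_index j + I)"
    using e_closed[OF mem] by (simp add: smult_facts(4) add.commute)
  finally show ?case using b(1) w_pos[OF step(1,2)] by (intro exI[of _ "b * w I j"]) simp
qed

text \<open>\<open>\<beta> I\<close> is the product of the weights along any path from 0 to \<open>I\<close>.\<close>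
definition \<beta> :: "multi_index \<Rightarrow> real" where
  "\<beta> I = (SOME b. b > 0 \<and> \<rho> (Poly_Mapping.single I 1) (e 0) = complex_of_real b \<odot>\<^bsub>H\<^esub> e I)"

lemma \<beta>:
  assumes "I \<in> multi_indices d"
  shows "\<beta> I > 0" "\<rho> (Poly_Mapping.single I 1) (e 0) = complex_of_real (\<beta> I) \<odot>\<^bsub>H\<^esub> e I"
  using someI_ex[OF monomial_vacuum[OF assms]] unfolding \<beta>_def by blast+

lemma hnorm_monomial_vacuum:
  "I \<in> multi_indices d \<Longrightarrow> hnorm H (\<rho> (Poly_Mapping.single I 1) (e 0)) = \<beta> I"
  using \<beta>[of I] by (simp add: hnorm_smult e_closed hnorm_e)

text \<open>Passing from \<open>J\<close> to \<open>I + J\<close> means applying contractions to \<open>T\<^sup>J e\<^sub>0\<close>.\<close>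
lemma \<beta>_decreasing:
  assumes "I \<in> multi_indices d" "J \<in> multi_indices d"
  shows "\<beta> (I + J) \<le> \<beta> J"
  using assms(1)
proof (induction rule: multi_index_induct)
  case (step I j)
  have mem: "I + J \<in> multi_indices d" using step assms by (intro multi_indices_add)
  then have mem': "unit_index j + (I + J) \<in> multi_indices d"
    by (rule multi_indices_add[OF unit_index_in[OF step(2)]])
  let ?x = "\<rho> (Poly_Mapping.single (I + J) 1) (e 0)"
  have x: "?x \<in> carrier H" by (intro rep_closed polys_single mem e_closed zero_index)
  have "\<beta> (unit_index j + (I + J)) = hnorm H (\<rho> (var_poly j) ?x)"
    using step(1,2) mem mem'
    by (simp add: hnorm_monomial_vacuum[symmetric] rep_unit_monomial e_closed zero_index)
  also have "\<dots> \<le> op_norm H (\<rho> (var_poly j)) * hnorm H ?x"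
    by (rule op_norm_bound[OF rep_bounded[OF var_poly_polys] x]) (rule step)
  also have "\<dots> \<le> 1 * hnorm H ?x"
    by (rule mult_right_mono) (use contractive[OF step(2)] hnorm_nonneg[OF x] in auto)
  also have "\<dots> = \<beta> (I + J)" using mem by (simp add: hnorm_monomial_vacuum)
  also have "\<dots> \<le> \<beta> J" by (rule step)
  finally show ?case by (simp add: add.assoc)
qed simp

lemma rep_single_vacuum:
  assumes "I \<in> multi_indices d"
  shows "\<rho> (Poly_Mapping.single I c) (e 0) = (c * complex_of_real (\<beta> I)) \<odot>\<^bsub>H\<^esub> e I"
proof -
  have "\<rho> (Poly_Mapping.single I c) (e 0) = c \<odot>\<^bsub>H\<^esub> \<rho> (Poly_Mapping.single I 1) (e 0)"
    using rep_smult[OF polys_single[OF assms] e_closed[OF zero_index], of c 1]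
    by (simp add: const_poly_def mult_single)
  then show ?thesis using assms by (simp add: \<beta> smult_facts(4) e_closed)
qed

text \<open>
  The representation space is thus identified with a weighted sequence space of coefficients, in
  which the operators act by multiplication of polynomials.
\<close>
lemma hnorm_rep_vacuum:
  assumes q: "q \<in> polys d"
  shows "(hnorm H (\<rho> q (e 0)))\<^sup>2 = (\<Sum>I\<in>Poly_Mapping.keys q. (cmod (Poly_Mapping.lookup q I))\<^sup>2 * (\<beta> I)\<^sup>2)"
proof -
  let ?K = "Poly_Mapping.keys q"
  have K: "?K \<subseteq> multi_indices d" using q by (simp add: polys_def)
  have "\<rho> q (e 0) = \<rho> (\<Sum>I\<in>?K. Poly_Mapping.single I (Poly_Mapping.lookup q I)) (e 0)"
    by (simp only: poly_mapping_sum_singles[symmetric])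
  also have "\<dots> = (\<Oplus>\<^bsub>H\<^esub>I\<in>?K. \<rho> (Poly_Mapping.single I (Poly_Mapping.lookup q I)) (e 0))"
    by (rule rep_sum) (use K in \<open>auto intro: polys_single e_closed zero_index\<close>)
  also have "\<dots> = (\<Oplus>\<^bsub>H\<^esub>I\<in>?K. (Poly_Mapping.lookup q I * complex_of_real (\<beta> I)) \<odot>\<^bsub>H\<^esub> e I)"
    by (rule M.finsum_cong') (use K in \<open>auto simp: rep_single_vacuum e_closed subset_iff\<close>)
  finally have "(hnorm H (\<rho> q (e 0)))\<^sup>2 =
      (\<Sum>I\<in>?K. (cmod (Poly_Mapping.lookup q I * complex_of_real (\<beta> I)))\<^sup>2)"
    using hnorm_orthonormal_sum[OF _ K basis] by simp
  then show ?thesis by (simp add: norm_mult power_mult_distrib)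
qed

text \<open>
  Since no \<open>\<beta> I\<close> vanishes, every finite combination of basis vectors is \<open>q(T) e\<^sub>0\<close> for some \<open>q\<close>.
\<close>
lemma vacuum_dense:
  assumes "x \<in> carrier H" "\<epsilon> > 0"
  shows "\<exists>q\<in>polys d. hnorm H (x \<ominus>\<^bsub>H\<^esub> \<rho> q (e 0)) < \<epsilon>"
proof -
  obtain F c where F: "finite F" "F \<subseteq> multi_indices d"
    and close: "hnorm H (x \<ominus>\<^bsub>H\<^esub> (\<Oplus>\<^bsub>H\<^esub>i\<in>F. c i \<odot>\<^bsub>H\<^esub> e i)) < \<epsilon>"
    using basis assms unfolding orthonormal_basis_def by blast
  define q where "q = (\<Sum>I\<in>F. Poly_Mapping.single I (c I / complex_of_real (\<beta> I)))"
  have q: "q \<in> polys d" unfolding q_def by (intro polys_sum polys_single) (use F in auto)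
  have "\<rho> q (e 0) = (\<Oplus>\<^bsub>H\<^esub>I\<in>F. \<rho> (Poly_Mapping.single I (c I / complex_of_real (\<beta> I))) (e 0))"
    unfolding q_def by (rule rep_sum) (use F in \<open>auto intro: polys_single e_closed zero_index\<close>)
  also have "\<dots> = (\<Oplus>\<^bsub>H\<^esub>I\<in>F. c I \<odot>\<^bsub>H\<^esub> e I)"
  proof (rule M.finsum_cong')
    fix I assume "I \<in> F"
    then have I: "I \<in> multi_indices d" using F by auto
    then have "\<beta> I > 0" by (rule \<beta>)
    then show "\<rho> (Poly_Mapping.single I (c I / complex_of_real (\<beta> I))) (e 0) = c I \<odot>\<^bsub>H\<^esub> e I"
      using I by (simp add: rep_single_vacuum)
  qed (use F in \<open>auto intro: e_closed\<close>)
  finally show ?thesis using close q by (intro bexI[of _ q]) simp_all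
qed

lemma von_neumann_on_vacuum:
  assumes p: "p \<in> polys d" and q: "q \<in> polys d" and c: "c \<ge> 0"
    and bound: "\<And>z. (\<And>j. j \<in> {1..d} \<Longrightarrow> cmod (z j) = 1) \<Longrightarrow> cmod (eval_poly d z p) \<le> c"
  shows "hnorm H (\<rho> p (\<rho> q (e 0))) \<le> c * hnorm H (\<rho> q (e 0))"
proof (rule power2_le_imp_le)
  have e0: "e 0 \<in> carrier H" by (intro e_closed zero_index)
  have pq: "p * q \<in> polys d" using p q by (rule polys_mult)
  have "(hnorm H (\<rho> p (\<rho> q (e 0))))\<^sup>2 = (hnorm H (\<rho> (p * q) (e 0)))\<^sup>2"
    by (simp add: rep_mult[OF p q e0])
  also have "\<dots> = (\<Sum>I\<in>Poly_Mapping.keys (p * q). (cmod (Poly_Mapping.lookup (p * q) I))\<^sup>2 * (\<beta> I)\<^sup>2)"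
    by (rule hnorm_rep_vacuum[OF pq])
  also have "\<dots> \<le> c\<^sup>2 * (\<Sum>I\<in>Poly_Mapping.keys q. (cmod (Poly_Mapping.lookup q I))\<^sup>2 * (\<beta> I)\<^sup>2)"
  proof (rule mult_weighted_l2_bound[OF p q c bound])
    show "(\<beta> I)\<^sup>2 > 0" if "I \<in> multi_indices d" for I using \<beta>(1)[OF that] by simp
    show "(\<beta> (I + J))\<^sup>2 \<le> (\<beta> J)\<^sup>2" if "I \<in> multi_indices d" "J \<in> multi_indices d" for I J
      using \<beta>_decreasing[OF that] \<beta>(1)[OF multi_indices_add[OF that]] by (intro power_mono) simp_all
  qed
  also have "\<dots> = (c * hnorm H (\<rho> q (e 0)))\<^sup>2"
    by (simp add: hnorm_rep_vacuum[OF q] power_mult_distrib)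
  finally show "(hnorm H (\<rho> p (\<rho> q (e 0))))\<^sup>2 \<le> (c * hnorm H (\<rho> q (e 0)))\<^sup>2" .
  show "c * hnorm H (\<rho> q (e 0)) \<ge> 0"
    using c hnorm_nonneg[OF rep_closed[OF q e0]] by simp
qed

text \<open>The estimate extends from the dense subspace by continuity of \<open>p(T)\<close>.\<close>
lemma von_neumann_inequality:
  assumes p: "p \<in> polys d" and c: "c \<ge> 0"
    and bound: "\<And>z. (\<And>j. j \<in> {1..d} \<Longrightarrow> cmod (z j) = 1) \<Longrightarrow> cmod (eval_poly d z p) \<le> c"
  shows "op_norm H (\<rho> p) \<le> c"
proof (rule op_norm_le[OF c])
  fix x assume x: "x \<in> carrier H"
  define B where "B = \<bar>op_norm H (\<rho> p)\<bar>"
  have "hnorm H (\<rho> p x) \<le> c * hnorm H x + (c + B) * \<epsilon>" if \<epsilon>: "\<epsilon> > 0" for \<epsilon>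
  proof -
    obtain q where q: "q \<in> polys d" and close: "hnorm H (x \<ominus>\<^bsub>H\<^esub> \<rho> q (e 0)) < \<epsilon>"
      using vacuum_dense[OF x \<epsilon>] by blast
    define y where "y = \<rho> q (e 0)"
    define r where "r = x \<ominus>\<^bsub>H\<^esub> y"
    have y: "y \<in> carrier H" unfolding y_def by (intro rep_closed q e_closed zero_index)
    have r: "r \<in> carrier H" and r_small: "hnorm H r \<le> \<epsilon>"
      using x y close by (simp_all add: r_def y_def)
    have x_eq: "x = y \<oplus>\<^bsub>H\<^esub> r"
      unfolding r_def M.minus_eq using x y by (metis M.a_comm M.a_inv_closed M.add.m_lcomm M.r_neg M.r_zero)
    have y_eq: "y = x \<oplus>\<^bsub>H\<^esub> (- 1) \<odot>\<^bsub>H\<^esub> r"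
      unfolding x_eq uminus_eq_smult[OF r, symmetric] using r y
      by (metis M.a_assoc M.a_inv_closed M.r_neg M.r_zero)
    have "hnorm H y \<le> hnorm H x + hnorm H ((- 1) \<odot>\<^bsub>H\<^esub> r)"
      by (subst y_eq) (intro hnorm_triangle x smult_mem r)
    then have y_norm: "hnorm H y \<le> hnorm H x + \<epsilon>" using r r_small by (simp add: hnorm_smult)
    have "hnorm H (\<rho> p x) \<le> hnorm H (\<rho> p y) + hnorm H (\<rho> p r)"
      unfolding x_eq bounded_operator_add[OF rep_bounded[OF p] y r]
      by (intro hnorm_triangle rep_closed p y r)
    also have "hnorm H (\<rho> p y) \<le> c * hnorm H y"
      unfolding y_def by (rule von_neumann_on_vacuum[OF p q c bound])
    also have "hnorm H (\<rho> p r) \<le> B * \<epsilon>"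
    proof -
      have "hnorm H (\<rho> p r) \<le> op_norm H (\<rho> p) * hnorm H r"
        by (rule op_norm_bound[OF rep_bounded[OF p] r])
      also have "\<dots> \<le> B * \<epsilon>"
        by (rule mult_mono) (use r_small hnorm_nonneg[OF r] in \<open>auto simp: B_def\<close>)
      finally show ?thesis .
    qed
    also have "c * hnorm H y \<le> c * (hnorm H x + \<epsilon>)" by (rule mult_left_mono[OF y_norm c])
    finally show ?thesis by (simp add: algebra_simps)
  qed
  note approx = this
  show "hnorm H (\<rho> p x) \<le> c * hnorm H x"
  proof (rule field_le_epsilon)
    fix \<delta> :: real assume \<delta>: "\<delta> > 0"
    (* Adding 1 keeps the denominator positive even if c and B vanish. *)
    have pos: "c + B + 1 > 0" using c by (simp add: B_def add_nonneg_pos)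
    have "hnorm H (\<rho> p x) \<le> c * hnorm H x + (c + B) * (\<delta> / (c + B + 1))"
      by (rule approx) (use \<delta> pos in simp)
    also have "(c + B) * (\<delta> / (c + B + 1)) \<le> \<delta>" using \<delta> pos by (simp add: field_simps)
    finally show "hnorm H (\<rho> p x) \<le> c * hnorm H x + \<delta>" by simp
  qed
qed

end


section \<open>Weighted shifts are not isometric representations\<close>

theorem corollary1p2:
  fixes H :: "'a inner_product_structure"
    and \<rho> :: "cpoly \<Rightarrow> 'a \<Rightarrow> 'a"
    and d :: nat
  assumes "complex_hilbert_space H"
    and "isometric_representation TYPE('u) d H \<rho>"
    and "d \<ge> 3"
  shows "\<not> weighted_shift H d (\<lambda>j. \<rho> (var_poly j))"
proof
  assume "weighted_shift H d (\<lambda>j. \<rho> (var_poly j))"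
  then obtain e w where basis: "orthonormal_basis H (multi_indices d) e"
    and w_pos: "\<And>I j. I \<in> multi_indices d \<Longrightarrow> j \<in> {1..d} \<Longrightarrow> w I j > 0"
    and shift: "\<And>I j. I \<in> multi_indices d \<Longrightarrow> j \<in> {1..d} \<Longrightarrow>
      \<rho> (var_poly j) (e I) = complex_of_real (w I j) \<odot>\<^bsub>H\<^esub> e (I + unit_index j)"
    unfolding weighted_shift_def by blast
  interpret complex_hilbert_space H by fact
  have rep: "\<forall>p\<in>polys d. \<rho> p \<in> bounded_operators H"
    "\<forall>p\<in>polys d. \<forall>q\<in>polys d. \<forall>x\<in>carrier H. \<rho> (p + q) x = \<rho> p x \<oplus>\<^bsub>H\<^esub> \<rho> q x"
    "\<forall>c. \<forall>p\<in>polys d. \<forall>x\<in>carrier H. \<rho> (const_poly c * p) x = c \<odot>\<^bsub>H\<^esub> \<rho> p x"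
    "\<forall>p\<in>polys d. \<forall>q\<in>polys d. \<forall>x\<in>carrier H. \<rho> (p * q) x = \<rho> p (\<rho> q x)"
    "\<forall>x\<in>carrier H. \<rho> 1 x = x"
    "\<forall>p\<in>polys d. op_norm H (\<rho> p) = universal_norm TYPE('u) d p"
    using assms(2) unfolding isometric_representation_def by - (elim conjE, assumption)+

  have zero: "(0 :: multi_index) \<in> multi_indices d" by (simp add: multi_indices_def)
  have one_polys: "1 \<in> polys d" using polys_single[OF zero, of 1] by simp
  have var_polys: "var_poly j \<in> polys d" if "j \<in> {1..d}" for j
    unfolding var_poly_def by (intro polys_single unit_index_in that)

  (* H is not the zero space, so 1 and 0 have different universal norms. *)
  have e0: "e 0 \<in> carrier H" "hnorm H (e 0) = 1"
    using basis zero by (simp_all add: orthonormal_basis_def hnorm_def)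
  have "hnorm H (\<rho> 1 (e 0)) \<le> op_norm H (\<rho> 1) * hnorm H (e 0)"
    using rep(1) one_polys by (intro op_norm_bound e0) blast
  then have norm_one: "1 \<le> op_norm H (\<rho> 1)" using rep(5) e0 by simp
  have "\<rho> 0 x = \<zero>\<^bsub>H\<^esub>" if x: "x \<in> carrier H" for x
  proof -
    have "\<rho> (const_poly 0 * 0) x = 0 \<odot>\<^bsub>H\<^esub> \<rho> 0 x" using rep(3) polys_zero x by blast
    moreover have "\<rho> 0 x \<in> carrier H"
      by (rule bounded_operator_closed[OF _ x]) (use rep(1) polys_zero in blast)
    ultimately show ?thesis by (simp add: smult_facts(6))
  qed
  then have "op_norm H (\<rho> 0) \<le> 0" by (intro op_norm_le) simp_all
  with norm_one have norms: "universal_norm TYPE('u) d 1 \<noteq> universal_norm TYPE('u) d 0"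
    using rep(6) one_polys polys_zero[of d] by auto
  have "\<exists>(K :: 'u inner_product_structure) v.
      complex_hilbert_space K \<and> v \<in> carrier K \<and> v \<noteq> \<zero>\<^bsub>K\<^esub>"
  proof (rule ccontr)
    assume none: "\<not> ?thesis"
    have "universal_norm TYPE('u) d 1 = universal_norm TYPE('u) d 0"
    proof (rule universal_norm_trivial)
      show "x = \<zero>\<^bsub>K\<^esub>" if "complex_hilbert_space K" "x \<in> carrier K"
        for K :: "'u inner_product_structure" and x
        using none that by blast
    qed
    with norms show False by contradiction
  qed
  then obtain K :: "'u inner_product_structure" and v
    where K: "complex_hilbert_space K" "v \<in> carrier K" "v \<noteq> \<zero>\<^bsub>K\<^esub>"
    by blast
  obtain \<phi> :: "complex5 \<Rightarrow> 'u" where inj: "inj \<phi>" using ex_inj_complex5[OF K] ..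
  note model = transported_hilbert_space[OF inj]
    transported_kv_commuting_contractions[OF inj assms(3)]

  interpret shift_representation H d \<rho> e w
  proof unfold_locales
    show "op_norm H (\<rho> (var_poly j)) \<le> 1" if "j \<in> {1..d}" for j
      using universal_norm_var_le_1[OF model that] rep(6) var_polys[OF that] by simp
    show "\<rho> p \<in> bounded_operators H" if "p \<in> polys d" for p
      using rep(1) that by (rule bspec)
    show "\<rho> (p + q) x = \<rho> p x \<oplus>\<^bsub>H\<^esub> \<rho> q x"
      if "p \<in> polys d" "q \<in> polys d" "x \<in> carrier H" for p q x
      using rep(2) that by simp
    show "\<rho> (const_poly c * p) x = c \<odot>\<^bsub>H\<^esub> \<rho> p x" if "p \<in> polys d" "x \<in> carrier H" for c p x
      using rep(3) that by simp
    show "\<rho> (p * q) x = \<rho> p (\<rho> q x)"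
      if "p \<in> polys d" "q \<in> polys d" "x \<in> carrier H" for p q x
      using rep(4) that by simp
    show "\<rho> 1 x = x" if "x \<in> carrier H" for x
      using rep(5) that by (rule bspec)
  qed (fact basis w_pos shift)+

  have "op_norm H (\<rho> kaijser_varopoulos) \<le> 5"
  proof (rule von_neumann_inequality[OF kaijser_varopoulos_polys[OF assms(3)]])
    fix z :: "nat \<Rightarrow> complex"
    assume "\<And>j. j \<in> {1..d} \<Longrightarrow> cmod (z j) = 1"
    then show "cmod (eval_poly d z kaijser_varopoulos) \<le> 5"
      unfolding eval_kaijser_varopoulos[OF assms(3)]
      using assms(3) by (intro kaijser_varopoulos_torus_bound) auto
  qed simp
  moreover have "universal_norm TYPE('u) d kaijser_varopoulos > 5"
    using op_norm_transported_kv[OF inj assms(3)] op_norm_le_universal_norm[OF model]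
    by (rule less_le_trans)
  ultimately show False
    using rep(6) kaijser_varopoulos_polys[OF assms(3)] by simp
qed

end
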